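(* There are absolute constants $c,C>0$ such that for every $\epsilon\in(0,1/2)$ and every positive integer $m$ that is a perfect square with $m\ge c\log^2(1/\epsilon)$, there exists an $\epsilon$-pseudorandom projection (PRP) from $\mathbb{R}^m$ to $\mathbb{R}^{\sqrt{m}}$ with seed-length at most $C\log(m/\epsilon)$.
   Context: Let $\tilde m=\sqrt m$. $\mathsf{SO}(m)$ is the group of real orthogonal $m\times m$ matrices with determinant 1, with Haar (rotation-invariant) probability measure. A uniformly random projection $Q\in\mathbb{R}^{\tilde m\times m}$ is the matrix consisting of the first $\tilde m$ rows of a Haar-distributed element of $\mathsf{SO}(m)$. A projection from $\mathbb{R}^m$ to $\mathbb{R}^{\tilde m}$ is a matrix $P\in\mathbb{R}^{\tilde m\times m}$ with orthonormal rows. For real random variables $X,Y$, $\mathrm{dcdf}(X,Y)=\sup_{z\in\mathbb{R}}|\Pr[X\le z]-\Pr[Y\le z]|$. A distribution $\mathcal{D}$ on projections from $\mathbb{R}^m$ to $\mathbb{R}^{\tilde m}$ is an $\epsilon$-PRP if for every $w\in\mathbb{R}^m$, with $P\sim\mathcal{D}$, $Q$ a uniformly random projection, and $x$ uniform on the unit sphere $\mathbb{S}^{\tilde m-1}\subseteq\mathbb{R}^{\tilde m}$ independent of $P,Q$, one has $\mathrm{dcdf}(\langle Pw,x\rangle,\langle Qw,x\rangle)\le\epsilon$. Its seed-length is the number $r$ of random bits used to sample $P$, i.e. $\mathcal{D}$ is the distribution of $P(y)$ for $y$ uniform on $\{0,1\}^r$ and some map $y\mapsto P(y)$. *)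

theory Defs
  imports
    "HOL-Probability.Probability"
    "Jordan_Normal_Form.Determinant"
begin

text \<open>
  The dimension varies inside the statement, so vectors and matrices are those of
  \<open>Jordan_Normal_Form\<close>. Their types carry no topology; the Borel \<open>\<sigma>\<close>-algebras on
  \<open>carrier_vec n\<close> and \<open>carrier_mat n m\<close> are pulled back from the product \<open>\<sigma>\<close>-algebras
  along the coordinate maps.
\<close>

definition vec_borel :: "nat \<Rightarrow> real vec measure" where
  "vec_borel n = vimage_algebra (carrier_vec n)
     (\<lambda>v. \<lambda>i\<in>{..<n}. v $ i) (PiM {..<n} (\<lambda>_. borel))"

definition mat_borel :: "nat \<Rightarrow> nat \<Rightarrow> real mat measure" where
  "mat_borel n m = vimage_algebra (carrier_mat n m)
     (\<lambda>A. \<lambda>ij\<in>{..<n} \<times> {..<m}. A $$ ij) (PiM ({..<n} \<times> {..<m}) (\<lambda>_. borel))"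

definition projections :: "nat \<Rightarrow> nat \<Rightarrow> real mat set" where
  "projections n m = {P \<in> carrier_mat n m. P * transpose_mat P = 1\<^sub>m n}"

definition orthogonal_mats :: "nat \<Rightarrow> real mat set" where
  "orthogonal_mats m = {A \<in> carrier_mat m m. A * transpose_mat A = 1\<^sub>m m}"

definition SO :: "nat \<Rightarrow> real mat set" where
  "SO m = {A \<in> orthogonal_mats m. Determinant.det A = 1}"

definition unit_sphere :: "nat \<Rightarrow> real vec set" where
  "unit_sphere n = {x \<in> carrier_vec n. sqrt (scalar_prod x x) = 1}"

definition projection_space :: "nat \<Rightarrow> nat \<Rightarrow> real mat measure" where
  "projection_space n m = restrict_space (mat_borel n m) (projections n m)"

definition haar_SO :: "nat \<Rightarrow> real mat measure \<Rightarrow> bool" where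
  "haar_SO m H \<longleftrightarrow>
     prob_space H \<and>
     space H = SO m \<and> sets H = sets (restrict_space (mat_borel m m) (SO m)) \<and>
     (\<forall>A\<in>SO m. distr H H (\<lambda>B. A * B) = H \<and> distr H H (\<lambda>B. B * A) = H)"

text \<open>
  Invariance is required under all orthogonal matrices rather than only under \<open>SO n\<close>: for
  \<open>n \<ge> 2\<close> both single out the normalised surface measure, but \<open>SO 1\<close> is trivial and
  does not single out the uniform measure on the two points of \<open>unit_sphere 1\<close>.
\<close>

definition uniform_sphere :: "nat \<Rightarrow> real vec measure \<Rightarrow> bool" where
  "uniform_sphere n S \<longleftrightarrow>
     prob_space S \<and>
     space S = unit_sphere n \<and> sets S = sets (restrict_space (vec_borel n) (unit_sphere n)) \<and>
     (\<forall>A\<in>orthogonal_mats n. distr S S (\<lambda>x. A *\<^sub>v x) = S)"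

definition first_rows :: "nat \<Rightarrow> real mat \<Rightarrow> real mat" where
  "first_rows n A = mat n (dim_col A) (\<lambda>ij. A $$ ij)"

definition random_projection :: "nat \<Rightarrow> nat \<Rightarrow> real mat measure \<Rightarrow> real mat measure" where
  "random_projection n m H = distr H (projection_space n m) (first_rows n)"

definition dcdf ::
  "'a measure \<Rightarrow> ('a \<Rightarrow> real) \<Rightarrow> 'b measure \<Rightarrow> ('b \<Rightarrow> real) \<Rightarrow> real" where
  "dcdf M X N Y = (SUP z. \<bar>measure M {a \<in> space M. X a \<le> z} - measure N {b \<in> space N. Y b \<le> z}\<bar>)"

text \<open>
  The Haar measure on \<open>SO m\<close> and the uniform measure on \<open>unit_sphere n\<close> (\<open>n \<ge> 1\<close>) exist and
  are unique, so quantifying over \<open>H\<close> and \<open>S\<close> just names them. The independence of \<open>x\<close> from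
  the projections is expressed by the product measures.
\<close>

definition is_PRP :: "real \<Rightarrow> nat \<Rightarrow> nat \<Rightarrow> real mat measure \<Rightarrow> bool" where
  "is_PRP \<epsilon> n m D \<longleftrightarrow>
     prob_space D \<and>
     space D = projections n m \<and> sets D = sets (projection_space n m) \<and>
     (\<forall>H S. haar_SO m H \<longrightarrow> uniform_sphere n S \<longrightarrow>
       (\<forall>w\<in>carrier_vec m.
          dcdf (D \<Otimes>\<^sub>M S) (\<lambda>(P, x). scalar_prod (P *\<^sub>v w) x)
               (random_projection n m H \<Otimes>\<^sub>M S) (\<lambda>(Q, x). scalar_prod (Q *\<^sub>v w) x) \<le> \<epsilon>))"

definition has_seed_length :: "nat \<Rightarrow> nat \<Rightarrow> real mat measure \<Rightarrow> nat \<Rightarrow> bool" where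
  "has_seed_length n m D r \<longleftrightarrow>
     (\<exists>P \<in> {y :: bool list. length y = r} \<rightarrow> projections n m.
        D = distr (uniform_count_measure {y. length y = r}) (projection_space n m) P)"

end

(*
  No explicit construction is needed: a uniform sample of poly(m / eps) Haar-random projections is
  a PRP, and its seed is an index into the sample. Writing u for the transpose of P applied to x,
  one has <Pw, x> = <w, u> with u a unit vector.  Finitely many rounded pairs (w, z) are handled by
  Hoeffding's lemma and a greedy choice of the sample.  Passing to arbitrary (w, z) requires that
  <w, u> does not concentrate on short intervals for Haar-random P.  Some coordinate u_b has square
  at least 1 / m and, after scaling, some w_a has absolute value 1; among K rational rotations of
  the (a, b)-plane, which preserve the Haar measure, at most two put <w, u> into a given strip of
  width about 1 / (m K^4), because the strip condition is a quadratic inequality in the rotation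
  parameter.  The rounding leaves (m / eps)^O(m) tests,
  whose number has logarithm polynomial in m / eps.

  Haar measure on SO(m) and the half-space probabilities of the uniform measure on the sphere are
  unique by a Fubini argument, so one sample serves for all of them.
*)
theory Submission
  imports Defs
begin

section \<open>Sampling\<close>

text \<open>The obstacle is uniformity over the continuum of pairs \<open>(w, z)\<close>. The
  sampled law offers no useful modulus of continuity: a sampled \<open>P\<close> has a kernel, so
  for some \<open>w\<close> the form \<open><Pw, x>\<close> vanishes identically. What survives on
  that side is monotonicity in \<open>z\<close>, and it suffices, provided the Haar side alone has a
  modulus of continuity at a scale polynomial in \<open>\<epsilon> / m\<close>.

  A very weak modulus is affordable because logarithms enter twice: the sample size depends on the
  logarithm of the number of tests, and the seed on the logarithm of the sample size. Hence no
  density of any spherical law is computed; invariance under finitely many rotations and a counting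
  argument give probability at most \<open>2 * m / K\<close> for strips of half-width about
  \<open>1 / (12 * m * K ^ 4)\<close>. Taking the tangent of the half angle to be an integer makes
  the counting quantitative: distinct parameters differ by at least 1, so a quadratic that is small
  at three of them has small coefficients.\<close>

lemma (in prob_space) expectation_exp_le:
  fixes f :: "'a \<Rightarrow> real"
  assumes f [measurable]: "f \<in> borel_measurable M" and bd: "\<And>x. x \<in> space M \<Longrightarrow> f x \<in> {0..1}" and l: "l > 0"
  shows "integrable M (\<lambda>x. exp (l * (f x - expectation f)))"
    and "expectation (\<lambda>x. exp (l * (f x - expectation f))) \<le> exp (l\<^sup>2 / 8)"
proof -
  interpret interval_bounded_random_variable M f 0 1
    by unfold_locales (use bd in auto)
  have mu: "0 \<le> expectation f"
    by (rule integral_nonneg_AE) (use bd in auto)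
  show int: "integrable M (\<lambda>x. exp (l * (f x - expectation f)))"
  proof (rule integrable_const_bound[where B = "exp l"])
    show "AE x in M. norm (exp (l * (f x - expectation f))) \<le> exp l"
    proof (rule AE_I2)
      fix x assume "x \<in> space M"
      then have "f x - expectation f \<le> 1" using bd[of x] mu by auto
      then show "norm (exp (l * (f x - expectation f))) \<le> exp l" using l by simp
    qed
  qed simp
  \<comment> \<open>Hoeffding's lemma has the factor (b - a)^2 / 8, here with the range [0, 1].
    Integrability turns the bound on the nonnegative integral into one on the real
    expectation.\<close>
  have "ennreal (expectation (\<lambda>x. exp (l * (f x - expectation f))))
      = (\<integral>\<^sup>+x. exp (l * (f x - expectation f)) \<partial>M)"
    by (rule nn_integral_eq_integral[symmetric, OF int]) simp
  also have "\<dots> \<le> ennreal (exp (l\<^sup>2 / 8))"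
    using Hoeffdings_lemma_nn_integral[OF l] by simp
  finally show "expectation (\<lambda>x. exp (l * (f x - expectation f))) \<le> exp (l\<^sup>2 / 8)"
    by simp
qed

lemma (in prob_space) exists_le_expectation:
  fixes g :: "'a \<Rightarrow> real"
  assumes "integrable M g"
  shows "\<exists>x\<in>space M. g x \<le> expectation g"
proof (rule ccontr)
  assume "\<not> ?thesis"
  then have "AE x in M. expectation g < g x" by (intro AE_I2) auto
  then show False using expectation_greater[OF assms, of "expectation g"] by simp
qed

text \<open>The points are chosen one after the other, each one no worse than average for the
  exponential potential.\<close>

lemma (in prob_space) exists_small_exp_potential:
  fixes f :: "'t \<Rightarrow> 'a \<Rightarrow> real"
  assumes T: "finite T" and Y: "finite Y" and l: "l > 0"
    and f: "\<And>t. t \<in> T \<Longrightarrow> f t \<in> borel_measurable M"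
    and bd: "\<And>t x. t \<in> T \<Longrightarrow> x \<in> space M \<Longrightarrow> f t x \<in> {0..1}"
  shows "\<exists>P\<in>Y \<rightarrow> space M. (\<Sum>t\<in>T. exp (l * (\<Sum>y\<in>Y. f t (P y) - expectation (f t))))
           \<le> card T * exp (l\<^sup>2 / 8) ^ card Y"
  using Y
proof (induction Y)
  case empty
  show ?case by auto
next
  case (insert y Y)
  then obtain P where P: "P \<in> Y \<rightarrow> space M"
    and le: "(\<Sum>t\<in>T. exp (l * (\<Sum>y\<in>Y. f t (P y) - expectation (f t)))) \<le> card T * exp (l\<^sup>2 / 8) ^ card Y"
    by blast
  define W where "W t = exp (l * (\<Sum>y\<in>Y. f t (P y) - expectation (f t)))" for t
  \<comment> \<open>\<open>W t\<close> freezes the points already chosen. Averaging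
    \<open>?g\<close> over the new point multiplies every weight by at most
    \<open>exp (l\<^sup>2 / 8)\<close>, so some new point does no worse.\<close>
  let ?g = "\<lambda>x. \<Sum>t\<in>T. W t * exp (l * (f t x - expectation (f t)))"
  have int: "integrable M (\<lambda>x. W t * exp (l * (f t x - expectation (f t))))" if "t \<in> T" for t
    using expectation_exp_le(1)[OF f[OF that] bd[OF that] l] by simp
  have "integrable M ?g" using int by simp
  then obtain x where x: "x \<in> space M" "?g x \<le> expectation ?g"
    using exists_le_expectation by blast
  note x(2)
  also have "expectation ?g = (\<Sum>t\<in>T. W t * expectation (\<lambda>x. exp (l * (f t x - expectation (f t)))))"
    using int by (simp add: Bochner_Integration.integral_sum)
  also have "\<dots> \<le> (\<Sum>t\<in>T. W t * exp (l\<^sup>2 / 8))"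
    by (intro sum_mono mult_left_mono expectation_exp_le(2) f bd l) (auto simp: W_def)
  also have "\<dots> = (\<Sum>t\<in>T. W t) * exp (l\<^sup>2 / 8)" by (simp add: sum_distrib_right)
  also have "\<dots> \<le> (card T * exp (l\<^sup>2 / 8) ^ card Y) * exp (l\<^sup>2 / 8)"
    using le by (intro mult_right_mono) (auto simp: W_def)
  also have "\<dots> = card T * exp (l\<^sup>2 / 8) ^ card (insert y Y)"
    using insert by simp
  finally have g: "?g x \<le> card T * exp (l\<^sup>2 / 8) ^ card (insert y Y)" .
  have eq: "(\<Sum>z\<in>insert y Y. f t ((P(y := x)) z) - expectation (f t)) =
      (f t x - expectation (f t)) + (\<Sum>z\<in>Y. f t (P z) - expectation (f t))" for t
  proof -
    have "(\<Sum>z\<in>Y. f t ((P(y := x)) z) - expectation (f t)) = (\<Sum>z\<in>Y. f t (P z) - expectation (f t))"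
      by (rule sum.cong) (use insert in auto)
    then show ?thesis using insert by simp
  qed
  show ?case
  proof (rule bexI[of _ "P(y := x)"])
    show "P(y := x) \<in> insert y Y \<rightarrow> space M" using P x by auto
    have "(\<Sum>t\<in>T. exp (l * (\<Sum>z\<in>insert y Y. f t ((P(y := x)) z) - expectation (f t)))) = ?g x"
      unfolding eq W_def by (simp add: distrib_left exp_add mult.commute)
    then show "(\<Sum>t\<in>T. exp (l * (\<Sum>z\<in>insert y Y. f t ((P(y := x)) z) - expectation (f t))))
        \<le> card T * exp (l\<^sup>2 / 8) ^ card (insert y Y)" using g by simp
  qed
qed

text \<open>A union bound without a product space: every deviation is the exponent of one term of a
  nonnegative potential, so a bound on the whole sum bounds each of them.\<close>

lemma (in prob_space) exists_uniform_sample: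
  fixes f :: "'t \<Rightarrow> 'a \<Rightarrow> real"
  assumes T: "finite T" "T \<noteq> {}" and Y: "finite Y" "Y \<noteq> {}" and e: "e > 0"
    and f: "\<And>t. t \<in> T \<Longrightarrow> f t \<in> borel_measurable M"
    and bd: "\<And>t x. t \<in> T \<Longrightarrow> x \<in> space M \<Longrightarrow> f t x \<in> {0..1}"
    and size: "ln (2 * card T) \<le> e\<^sup>2 / 4 * card Y"
  shows "\<exists>P\<in>Y \<rightarrow> space M. \<forall>t\<in>T. \<bar>(\<Sum>y\<in>Y. f t (P y)) / card Y - expectation (f t)\<bar> \<le> e"
proof -
  \<comment> \<open>The flag adds the complement of every test, so that upper deviations of the
    doubled family control both signs. This is the factor 2 in
    \<open>ln (2 * card T)\<close>.\<close>
  define g where "g = (\<lambda>(t, b) x. if b then f t x else 1 - f t x)"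
  have gm: "g s \<in> borel_measurable M" if "s \<in> T \<times> UNIV" for s
  proof (cases s)
    case (Pair t b)
    then have [measurable]: "f t \<in> borel_measurable M" using that f by auto
    show ?thesis unfolding g_def Pair by (cases b) auto
  qed
  have gb: "g s x \<in> {0..1}" if "s \<in> T \<times> UNIV" "x \<in> space M" for s x
    using that bd[of "fst s" x] by (auto simp: g_def split: prod.splits)
  have "2 * e > 0" using e by simp
  from exists_small_exp_potential[of "T \<times> (UNIV :: bool set)" Y "2 * e" g, OF _ Y(1) this gm gb]
  obtain P where P: "P \<in> Y \<rightarrow> space M"
    and le: "(\<Sum>s\<in>T \<times> UNIV. exp (2 * e * (\<Sum>y\<in>Y. g s (P y) - expectation (g s))))
        \<le> card (T \<times> (UNIV :: bool set)) * exp ((2 * e)\<^sup>2 / 8) ^ card Y"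
    using T by auto
  have cT: "real (card T) > 0" using T by (simp add: card_gt_0_iff)
  have cY: "real (card Y) > 0" using Y by (simp add: card_gt_0_iff)
  have dev: "(\<Sum>y\<in>Y. g s (P y) - expectation (g s)) \<le> e * card Y" if "s \<in> T \<times> UNIV" for s
  proof -
    have "exp (2 * e * (\<Sum>y\<in>Y. g s (P y) - expectation (g s)))
        \<le> (\<Sum>s\<in>T \<times> UNIV. exp (2 * e * (\<Sum>y\<in>Y. g s (P y) - expectation (g s))))"
      by (rule member_le_sum) (use that T in auto)
    also note le
    also have "card (T \<times> (UNIV :: bool set)) * exp ((2 * e)\<^sup>2 / 8) ^ card Y
        = exp (ln (2 * card T) + card Y * (e\<^sup>2 / 2))"
      using cT by (simp add: exp_add exp_of_nat_mult[symmetric] card_cartesian_product power2_eq_square)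
    finally have "2 * e * (\<Sum>y\<in>Y. g s (P y) - expectation (g s)) \<le> ln (2 * card T) + card Y * (e\<^sup>2 / 2)"
      by simp
    also have "\<dots> \<le> e\<^sup>2 / 4 * card Y + card Y * (e\<^sup>2 / 2)" using size by (simp add: mult.commute)
    \<comment> \<open>With the parameter \<open>l = 2 * e\<close> the left side is 3/4 of e^2 |Y|,
      which leaves ample room below 2 e^2 |Y|.\<close>
    also have "\<dots> \<le> 2 * e * (e * card Y)" using e by (simp add: power2_eq_square)
    finally show ?thesis using e by simp
  qed
  show ?thesis
  proof (intro bexI[of _ P] ballI P)
    fix t assume t: "t \<in> T"
    have [measurable]: "f t \<in> borel_measurable M" by (rule f[OF t])
    have int: "integrable M (f t)"
      by (rule integrable_const_bound[where B = 1]) (use bd t in auto)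
    have "(\<Sum>y\<in>Y. f t (P y) - expectation (f t)) \<le> e * card Y"
      using dev[of "(t, True)"] t by (simp add: g_def)
    then have 1: "(\<Sum>y\<in>Y. f t (P y)) - card Y * expectation (f t) \<le> e * card Y"
      by (simp add: sum_subtractf)
    have "expectation (\<lambda>x. 1 - f t x) = 1 - expectation (f t)"
      using int by (simp add: prob_space)
    then have "(\<Sum>y\<in>Y. 1 - f t (P y) - (1 - expectation (f t))) \<le> e * card Y"
      using dev[of "(t, False)"] t by (simp add: g_def)
    then have 2: "card Y * expectation (f t) - (\<Sum>y\<in>Y. f t (P y)) \<le> e * card Y"
      by (simp add: sum_subtractf)
    from 1 2 have "\<bar>(\<Sum>y\<in>Y. f t (P y)) - card Y * expectation (f t)\<bar> \<le> e * card Y" by linarith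
    then show "\<bar>(\<Sum>y\<in>Y. f t (P y)) / card Y - expectation (f t)\<bar> \<le> e"
      using cY by (simp add: abs_le_iff field_simps)
  qed
qed

section \<open>Haar measure and the uniform measure on the sphere\<close>

no_notation Finite_Cartesian_Product.vec.vec_nth (infixl \<open>$\<close> 90)

section \<open>Coordinatewise measurability, orthogonal matrices and Haar measure\<close>

lemma space_mat_borel [simp]: "space (mat_borel n m) = carrier_mat n m"
  and space_vec_borel [simp]: "space (vec_borel n) = carrier_vec n"
  by (simp_all add: mat_borel_def vec_borel_def space_vimage_algebra)

lemma measurable_mat_index:
  assumes "i < n" "j < m"
  shows "(\<lambda>A. A $$ (i, j)) \<in> borel_measurable (mat_borel n m)"
proof -
  have "(\<lambda>A. (\<lambda>ij\<in>{..<n} \<times> {..<m}. A $$ ij) (i, j)) \<in> borel_measurable (mat_borel n m)"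
    unfolding mat_borel_def
    by (rule measurable_compose[OF measurable_vimage_algebra1 measurable_component_singleton])
      (use assms in \<open>auto simp: space_PiM PiE_def extensional_def\<close>)
  then show ?thesis using assms by simp
qed

lemma measurable_vec_index:
  assumes "i < n"
  shows "(\<lambda>v. v $ i) \<in> borel_measurable (vec_borel n)"
proof -
  have "(\<lambda>v. (\<lambda>i\<in>{..<n}. v $ i) i) \<in> borel_measurable (vec_borel n)"
    unfolding vec_borel_def
    by (rule measurable_compose[OF measurable_vimage_algebra1 measurable_component_singleton])
      (use assms in \<open>auto simp: space_PiM PiE_def extensional_def\<close>)
  then show ?thesis using assms by simp
qed

lemma measurable_mat_borelI:
  assumes "\<And>x. x \<in> space N \<Longrightarrow> f x \<in> carrier_mat n m"
    and "\<And>i j. i < n \<Longrightarrow> j < m \<Longrightarrow> (\<lambda>x. f x $$ (i, j)) \<in> borel_measurable N"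
  shows "f \<in> measurable N (mat_borel n m)"
  unfolding mat_borel_def
proof (rule measurable_vimage_algebra2)
  show "(\<lambda>x. \<lambda>ij\<in>{..<n} \<times> {..<m}. f x $$ ij) \<in> N \<rightarrow>\<^sub>M PiM ({..<n} \<times> {..<m}) (\<lambda>_. borel)"
    by (rule measurable_restrict) (use assms in auto)
qed (use assms in auto)

lemma measurable_vec_borelI:
  assumes "\<And>x. x \<in> space N \<Longrightarrow> f x \<in> carrier_vec n"
    and "\<And>i. i < n \<Longrightarrow> (\<lambda>x. f x $ i) \<in> borel_measurable N"
  shows "f \<in> measurable N (vec_borel n)"
  unfolding vec_borel_def
proof (rule measurable_vimage_algebra2)
  show "(\<lambda>x. \<lambda>i\<in>{..<n}. f x $ i) \<in> N \<rightarrow>\<^sub>M PiM {..<n} (\<lambda>_. borel)"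
    by (rule measurable_restrict) (use assms in auto)
qed (use assms in auto)

lemma haar_SO_prob: "haar_SO m H \<Longrightarrow> prob_space H"
  and space_haar_SO: "haar_SO m H \<Longrightarrow> space H = SO m"
  by (simp_all add: haar_SO_def)

lemma measurable_into_haar_SO:
  assumes H: "haar_SO m H"
    and "\<And>x. x \<in> space N \<Longrightarrow> f x \<in> SO m"
    and "\<And>i j. i < m \<Longrightarrow> j < m \<Longrightarrow> (\<lambda>x. f x $$ (i, j)) \<in> borel_measurable N"
  shows "f \<in> measurable N H"
proof -
  have "f \<in> measurable N (restrict_space (mat_borel m m) (SO m))"
    by (intro measurable_restrict_space2 measurable_mat_borelI)
      (use assms in \<open>auto simp: SO_def orthogonal_mats_def\<close>)
  moreover have "measurable N H = measurable N (restrict_space (mat_borel m m) (SO m))"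
    using H by (intro measurable_cong_sets) (auto simp: haar_SO_def)
  ultimately show ?thesis by simp
qed

lemma measurable_haar_SO_index:
  assumes "haar_SO m H" "i < m" "j < m"
  shows "(\<lambda>A. A $$ (i, j)) \<in> borel_measurable H"
proof -
  have "measurable H borel = measurable (restrict_space (mat_borel m m) (SO m)) borel"
    using assms by (intro measurable_cong_sets) (auto simp: haar_SO_def)
  then show ?thesis
    using measurable_restrict_space1[OF measurable_mat_index[of i m j m]] assms by auto
qed

lemma SO_carrier: "A \<in> SO m \<Longrightarrow> A \<in> carrier_mat m m"
  by (simp add: SO_def orthogonal_mats_def)

lemma orthogonal_mats_mult:
  assumes "A \<in> orthogonal_mats m" "B \<in> orthogonal_mats m"
  shows "A * B \<in> orthogonal_mats m"
proof -
  have A: "A \<in> carrier_mat m m" "A * transpose_mat A = 1\<^sub>m m"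
    and B: "B \<in> carrier_mat m m" "B * transpose_mat B = 1\<^sub>m m"
    using assms by (auto simp: orthogonal_mats_def)
  have "A * B * transpose_mat (A * B) = A * (B * transpose_mat B) * transpose_mat A"
    using A(1) B(1) by (simp add: transpose_mult[OF A(1) B(1)] assoc_mult_mat[of _ m m _ m _ m])
  also have "\<dots> = 1\<^sub>m m" using A B by simp
  finally show ?thesis using A B by (simp add: orthogonal_mats_def)
qed

lemma SO_mult:
  assumes "A \<in> SO m" "B \<in> SO m"
  shows "A * B \<in> SO m"
  using assms orthogonal_mats_mult[of A m B] det_mult[of A m B]
  by (auto simp: SO_def orthogonal_mats_def)

text \<open>The determinant of \<open>A * A\<close> is det A squared, which is the determinant of
  \<open>A\<close> times its transpose. Membership in \<open>SO m\<close> thus follows without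
  knowing the sign of det A.\<close>

lemma orthogonal_square_SO:
  assumes "A \<in> orthogonal_mats m"
  shows "A * A \<in> SO m"
proof -
  have A: "A \<in> carrier_mat m m" "A * transpose_mat A = 1\<^sub>m m"
    using assms by (auto simp: orthogonal_mats_def)
  have "Determinant.det A * Determinant.det A = Determinant.det (A * transpose_mat A)"
    using A(1) by (simp add: det_mult[of A m] det_transpose)
  then show ?thesis
    using A orthogonal_mats_mult[OF assms assms] by (simp add: SO_def det_mult[of A m])
qed

lemma index_mult_mat_sum:
  assumes "A \<in> carrier_mat n k" "B \<in> carrier_mat k m" "i < n" "j < m"
  shows "(A * B) $$ (i, j) = (\<Sum>l<k. A $$ (i, l) * B $$ (l, j))"
  using assms by (auto simp: scalar_prod_def atLeast0LessThan intro!: sum.cong)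

lemma measurable_haar_SO_mult:
  assumes H: "haar_SO m H" and H': "haar_SO m H'"
  shows "(\<lambda>(A, B). A * B) \<in> measurable (H \<Otimes>\<^sub>M H') H"
proof (rule measurable_into_haar_SO[OF H])
  fix x assume "x \<in> space (H \<Otimes>\<^sub>M H')"
  then show "(case x of (A, B) \<Rightarrow> A * B) \<in> SO m"
    using SO_mult H H' by (auto simp: space_pair_measure space_haar_SO)
next
  fix i j assume ij: "i < m" "j < m"
  have 1: "(\<lambda>x. \<Sum>l<m. fst x $$ (i, l) * snd x $$ (l, j)) \<in> borel_measurable (H \<Otimes>\<^sub>M H')"
    by (intro borel_measurable_sum borel_measurable_times
        measurable_compose[OF measurable_fst measurable_haar_SO_index[OF H]]
        measurable_compose[OF measurable_snd measurable_haar_SO_index[OF H']]) (use ij in auto)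
  have eq: "(case x of (A, B) \<Rightarrow> A * B) $$ (i, j) = (\<Sum>l<m. fst x $$ (i, l) * snd x $$ (l, j))"
    if "x \<in> space (H \<Otimes>\<^sub>M H')" for x
  proof -
    have "fst x \<in> SO m" "snd x \<in> SO m"
      using that H H' by (auto simp: space_pair_measure space_haar_SO)
    then show ?thesis
      using index_mult_mat_sum[OF SO_carrier SO_carrier ij] by (simp add: case_prod_beta)
  qed
  show "(\<lambda>x. (case x of (A, B) \<Rightarrow> A * B) $$ (i, j)) \<in> borel_measurable (H \<Otimes>\<^sub>M H')"
    by (rule measurable_cong[OF eq, THEN iffD2, OF _ 1])
qed

text \<open>Both measures agree with the law of the product of two independent samples.\<close>

lemma haar_SO_unique:
  assumes H: "haar_SO m H" and H': "haar_SO m H'"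
  shows "H = H'"
proof (rule measure_eqI)
  show sets: "sets H = sets H'" using H H' by (simp add: haar_SO_def)
  fix X assume X: "X \<in> sets H"
  interpret H: prob_space H by (rule haar_SO_prob[OF H])
  interpret H': prob_space H' by (rule haar_SO_prob[OF H'])
  interpret pair_prob_space H H' ..
  have m: "(\<lambda>(A, B). indicator X (A * B) :: ennreal) \<in> borel_measurable (H \<Otimes>\<^sub>M H')"
    using measurable_compose[OF measurable_haar_SO_mult[OF H H'] borel_measurable_indicator[OF X]]
    by (simp add: case_prod_unfold)
  \<comment> \<open>The two inner integrals use one invariance each: with \<open>B\<close> fixed,
    right invariance of \<open>H\<close>; with \<open>A\<close> fixed, left invariance of
    \<open>H'\<close>.\<close>
  have right: "(\<integral>\<^sup>+ A. indicator X (A * B) \<partial>H) = emeasure H X" if "B \<in> space H'" for B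
  proof -
    have B: "B \<in> SO m" using that H' by (simp add: space_haar_SO)
    have "(\<lambda>A. A * B) \<in> measurable H H"
      using measurable_compose[OF measurable_Pair2'[OF that, of H] measurable_haar_SO_mult[OF H H']] 
      by simp
    then have "(\<integral>\<^sup>+ A. indicator X (A * B) \<partial>H) = (\<integral>\<^sup>+ A. indicator X A \<partial>distr H H (\<lambda>A. A * B))"
      by (intro nn_integral_distr[symmetric]) (use X in simp_all)
    also have "distr H H (\<lambda>A. A * B) = H" using H B by (simp add: haar_SO_def)
    finally show ?thesis using X by simp
  qed
  have left: "(\<integral>\<^sup>+ B. indicator X (A * B) \<partial>H') = emeasure H' X" if "A \<in> space H" for A
  proof -
    have A: "A \<in> SO m" using that H by (simp add: space_haar_SO)
    have X': "X \<in> sets H'" using X sets by simp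
    have "(\<lambda>B. A * B) \<in> measurable H' H"
      using measurable_compose[OF measurable_Pair1'[OF that, of H'] measurable_haar_SO_mult[OF H H']]
      by simp
    then have "(\<lambda>B. A * B) \<in> measurable H' H'"
      by (rule measurable_cong_sets[OF refl sets, THEN equalityD1, THEN subsetD])
    then have "(\<integral>\<^sup>+ B. indicator X (A * B) \<partial>H') = (\<integral>\<^sup>+ B. indicator X B \<partial>distr H' H' (\<lambda>B. A * B))"
      by (intro nn_integral_distr[symmetric]) (use X' in simp_all)
    also have "distr H' H' (\<lambda>B. A * B) = H'" using H' A by (simp add: haar_SO_def)
    finally show ?thesis using X' by simp
  qed
  have "emeasure H X = (\<integral>\<^sup>+ B. emeasure H X \<partial>H')" by (simp add: H'.emeasure_space_1)
  also have "\<dots> = (\<integral>\<^sup>+ B. \<integral>\<^sup>+ A. indicator X (A * B) \<partial>H \<partial>H')"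
    by (intro nn_integral_cong) (simp add: right)
  also have "\<dots> = (\<integral>\<^sup>+ A. \<integral>\<^sup>+ B. indicator X (A * B) \<partial>H' \<partial>H)"
    using Fubini'[OF m] by simp
  also have "\<dots> = (\<integral>\<^sup>+ A. emeasure H' X \<partial>H)"
    by (intro nn_integral_cong) (simp add: left)
  also have "\<dots> = emeasure H' X" by (simp add: H.emeasure_space_1)
  finally show "emeasure H X = emeasure H' X" .
qed

section \<open>Half-spaces and the uniform measure on the sphere\<close>

lemma scalar_prod_sum: "w \<in> carrier_vec n \<Longrightarrow> scalar_prod v w = (\<Sum>i<n. v $ i * w $ i)"
  by (simp add: scalar_prod_def atLeast0LessThan)

lemma mult_mat_vec_sum:
  "A \<in> carrier_mat n k \<Longrightarrow> v \<in> carrier_vec k \<Longrightarrow> i < n \<Longrightarrow> (A *\<^sub>v v) $ i = (\<Sum>l<k. A $$ (i, l) * v $ l)"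
  by (auto simp: scalar_prod_def atLeast0LessThan intro!: sum.cong)

text \<open>The Householder reflection along \<open>x - y\<close>.\<close>

lemma exists_orthogonal_swap:
  assumes x: "x \<in> carrier_vec n" and y: "y \<in> carrier_vec n"
    and eq: "scalar_prod x x = scalar_prod y y"
  shows "\<exists>U\<in>orthogonal_mats n. \<forall>p\<in>carrier_vec n. scalar_prod y (U *\<^sub>v p) = scalar_prod x p"
proof (cases "x = y")
  case True
  then show ?thesis by (intro bexI[of _ "1\<^sub>m n"]) (auto simp: orthogonal_mats_def)
next
  case False
  define v where "v i = x $ i - y $ i" for i
  define V where "V = (\<Sum>i<n. v i * v i)"
  define c where "c = 2 / V"
  obtain k where k: "k < n" "v k \<noteq> 0"
    using False x y by (auto simp: v_def vec_eq_iff)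
  have "V > 0" unfolding V_def
    by (rule sum_pos2[of _ k]) (use k in \<open>auto simp: zero_less_mult_iff\<close>)
  then have cV: "c * V = 2" by (simp add: c_def)
  define U where "U = mat n n (\<lambda>(i, j). (if i = j then 1 else 0) - c * v i * v j)"
  have U: "U \<in> carrier_mat n n" by (simp add: U_def)
  have "U * transpose_mat U = 1\<^sub>m n"
  proof (rule eq_matI)
    fix i j assume "i < dim_row (1\<^sub>m n :: real mat)" "j < dim_col (1\<^sub>m n :: real mat)"
    then have ij: "i < n" "j < n" by auto
    have "(U * transpose_mat U) $$ (i, j) = (\<Sum>l<n. U $$ (i, l) * U $$ (j, l))"
      using index_mult_mat_sum[OF U, of "transpose_mat U" n i j] U ij by simp
    also have "\<dots> = (\<Sum>l<n. (if l = i then (if l = j then 1 else 0) else 0) - (if l = i then c * v j * v l else 0)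
        - (if l = j then c * v i * v l else 0) + c * c * v i * v j * (v l * v l))"
      using ij by (intro sum.cong) (auto simp: U_def algebra_simps)
    also have "\<dots> = (if i = j then 1 else 0) - c * v j * v i - c * v i * v j + c * c * v i * v j * V"
      using ij by (simp add: sum.distrib sum_subtractf V_def sum_distrib_left del: if_cancel)
    \<comment> \<open>Since \<open>c * V = 2\<close>, this term cancels the two cross terms.\<close>
    also have "c * c * v i * v j * V = (c * V) * c * v i * v j" by simp
    finally show "(U * transpose_mat U) $$ (i, j) = 1\<^sub>m n $$ (i, j)"
      using ij unfolding cV by simp
  qed (auto simp: U_def)
  then have "U \<in> orthogonal_mats n" using U by (simp add: orthogonal_mats_def)
  moreover have "scalar_prod y (U *\<^sub>v p) = scalar_prod x p" if p: "p \<in> carrier_vec n" for p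
  proof -
    define vp where "vp = (\<Sum>l<n. v l * p $ l)"
    define vy where "vy = (\<Sum>l<n. v l * y $ l)"
    have Up: "(U *\<^sub>v p) $ i = p $ i - c * vp * v i" if "i < n" for i
    proof -
      have "(U *\<^sub>v p) $ i = (\<Sum>l<n. (if l = i then p $ l else 0) - c * v i * (v l * p $ l))"
        unfolding mult_mat_vec_sum[OF U p that]
        using that by (intro sum.cong) (auto simp: U_def algebra_simps)
      also have "\<dots> = p $ i - c * vp * v i"
        using that by (simp add: sum_subtractf vp_def sum_distrib_left sum_distrib_right mult_ac)
      finally show ?thesis .
    qed
    have ix: "y $ i * (U *\<^sub>v p) $ i = y $ i * p $ i - c * vp * (v i * y $ i)" if "i < n" for i
      unfolding Up[OF that] by (simp add: algebra_simps)
    have "scalar_prod y (U *\<^sub>v p) = (\<Sum>i<n. y $ i * (U *\<^sub>v p) $ i)"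
      by (rule scalar_prod_sum) (use U p in simp)
    also have "\<dots> = (\<Sum>i<n. y $ i * p $ i - c * vp * (v i * y $ i))"
      by (intro sum.cong refl ix) simp
    also have "\<dots> = (\<Sum>i<n. y $ i * p $ i) - c * vp * vy"
      by (simp add: sum_subtractf vy_def sum_distrib_left)
    also have "c * vp * vy = - vp"
    proof -
      have "c * vp * vy = vp * c * (2 * vy) / 2" by simp
      \<comment> \<open>Here the equality of norms enters: 2 <x - y, y> + |x - y|^2 = |x|^2 - |y|^2
        = 0. It says that the reflection maps \<open>y\<close> to \<open>x\<close>.\<close>
      also have "2 * vy = - V"
      proof -
        have "2 * vy + V = (\<Sum>l<n. x $ l * x $ l - y $ l * y $ l)"
          unfolding vy_def V_def sum_distrib_left sum.distrib[symmetric]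
          by (intro sum.cong) (auto simp: v_def algebra_simps)
        also have "\<dots> = 0" using eq x y by (simp add: sum_subtractf scalar_prod_sum[of _ n])
        finally show ?thesis by simp
      qed
      also have "vp * c * - V / 2 = - vp * (c * V) / 2" by simp
      finally show ?thesis using cV by simp
    qed
    also have "(\<Sum>i<n. y $ i * p $ i) - - vp = (\<Sum>i<n. x $ i * p $ i)"
      unfolding vp_def v_def by (simp add: algebra_simps sum_subtractf)
    finally show ?thesis using p by (simp add: scalar_prod_sum[of _ n])
  qed
  ultimately show ?thesis by blast
qed

lemma uniform_sphere_prob: "uniform_sphere n S \<Longrightarrow> prob_space S"
  and space_uniform_sphere: "uniform_sphere n S \<Longrightarrow> space S = unit_sphere n"
  by (simp_all add: uniform_sphere_def)

lemma unit_sphere_iff: "x \<in> unit_sphere n \<longleftrightarrow> x \<in> carrier_vec n \<and> (\<Sum>i<n. x $ i * x $ i) = 1"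
  by (auto simp: unit_sphere_def scalar_prod_sum)

lemma measurable_uniform_sphere_index:
  assumes "uniform_sphere n S" "i < n"
  shows "(\<lambda>x. x $ i) \<in> borel_measurable S"
proof -
  have "measurable S borel = measurable (restrict_space (vec_borel n) (unit_sphere n)) borel"
    using assms by (intro measurable_cong_sets) (auto simp: uniform_sphere_def)
  then show ?thesis
    using measurable_restrict_space1[OF measurable_vec_index[of i n]] assms by auto
qed

lemma measurable_into_uniform_sphere:
  assumes S: "uniform_sphere n S"
    and "\<And>x. x \<in> space N \<Longrightarrow> f x \<in> unit_sphere n"
    and "\<And>i. i < n \<Longrightarrow> (\<lambda>x. f x $ i) \<in> borel_measurable N"
  shows "f \<in> measurable N S"
proof -
  have "f \<in> measurable N (restrict_space (vec_borel n) (unit_sphere n))"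
    by (intro measurable_restrict_space2 measurable_vec_borelI)
      (use assms in \<open>auto simp: unit_sphere_def\<close>)
  moreover have "measurable N S = measurable N (restrict_space (vec_borel n) (unit_sphere n))"
    using S by (intro measurable_cong_sets) (auto simp: uniform_sphere_def)
  ultimately show ?thesis by simp
qed

lemma orthogonal_transpose_mult:
  assumes "U \<in> orthogonal_mats n"
  shows "transpose_mat U * U = 1\<^sub>m n"
  using assms mat_mult_left_right_inverse[of U n "transpose_mat U"]
  by (auto simp: orthogonal_mats_def)

lemma orthogonal_unit_sphere:
  assumes U: "U \<in> orthogonal_mats n" and x: "x \<in> unit_sphere n"
  shows "U *\<^sub>v x \<in> unit_sphere n"
proof -
  have Uc: "U \<in> carrier_mat n n" and xc: "x \<in> carrier_vec n"
    using U x by (auto simp: orthogonal_mats_def unit_sphere_def)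
  have "scalar_prod (U *\<^sub>v x) (U *\<^sub>v x) = scalar_prod (transpose_mat U *\<^sub>v (U *\<^sub>v x)) x"
    using Uc xc by (simp add: transpose_vec_mult_scalar[of U n n])
  also have "transpose_mat U *\<^sub>v (U *\<^sub>v x) = x"
    using Uc xc orthogonal_transpose_mult[OF U]
    by (simp flip: assoc_mult_mat_vec[of _ n n _ n])
  finally show ?thesis using x Uc xc by (simp add: unit_sphere_def)
qed

text \<open>An orthogonal matrix pulls one half-space back to the other, and \<open>S\<close> is
  invariant under it. The matrix may be a reflection, of determinant -1, which the invariance under
  all of \<open>orthogonal_mats\<close> covers.\<close>

lemma uniform_sphere_halfspace_cong:
  assumes S: "uniform_sphere n S" and x: "x \<in> carrier_vec n" and y: "y \<in> carrier_vec n"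
    and eq: "scalar_prod x x = scalar_prod y y"
  shows "emeasure S {p\<in>space S. scalar_prod x p \<le> z} = emeasure S {p\<in>space S. scalar_prod y p \<le> z}"
proof -
  obtain U where U: "U \<in> orthogonal_mats n"
    and swap: "\<And>p. p \<in> carrier_vec n \<Longrightarrow> scalar_prod y (U *\<^sub>v p) = scalar_prod x p"
    using exists_orthogonal_swap[OF x y eq] by blast
  have Uc: "U \<in> carrier_mat n n" using U by (simp add: orthogonal_mats_def)
  have sp: "space S = unit_sphere n" by (rule space_uniform_sphere[OF S])
  have car: "p \<in> carrier_vec n" if "p \<in> space S" for p
    using that sp by (simp add: unit_sphere_def)
  have mU: "(\<lambda>x. U *\<^sub>v x) \<in> measurable S S"
  proof (rule measurable_into_uniform_sphere[OF S])
    fix i assume i: "i < n"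
    have 1: "(\<lambda>x. \<Sum>l<n. U $$ (i, l) * x $ l) \<in> borel_measurable S"
      by (intro borel_measurable_sum borel_measurable_times measurable_uniform_sphere_index[OF S]) auto
    show "(\<lambda>x. (U *\<^sub>v x) $ i) \<in> borel_measurable S"
      by (rule measurable_cong[OF mult_mat_vec_sum[OF Uc car i], THEN iffD2, OF _ 1])
  qed (use orthogonal_unit_sphere[OF U] sp in auto)
  have my: "{p\<in>space S. scalar_prod y p \<le> z} \<in> sets S"
  proof -
    have 1: "(\<lambda>p. \<Sum>l<n. y $ l * p $ l) \<in> borel_measurable S"
      by (intro borel_measurable_sum borel_measurable_times measurable_uniform_sphere_index[OF S]) auto
    have 2: "(\<lambda>p. scalar_prod y p) \<in> borel_measurable S"
      by (rule measurable_cong[OF scalar_prod_sum[OF car], THEN iffD2, OF _ 1])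
    then show ?thesis by measurable
  qed
  have "emeasure S {p\<in>space S. scalar_prod y p \<le> z}
      = emeasure (distr S S (\<lambda>x. U *\<^sub>v x)) {p\<in>space S. scalar_prod y p \<le> z}"
    using S U by (simp add: uniform_sphere_def)
  also have "\<dots> = emeasure S ((\<lambda>x. U *\<^sub>v x) -` {p\<in>space S. scalar_prod y p \<le> z} \<inter> space S)"
    by (rule emeasure_distr[OF mU my])
  also have "(\<lambda>x. U *\<^sub>v x) -` {p\<in>space S. scalar_prod y p \<le> z} \<inter> space S
      = {p\<in>space S. scalar_prod x p \<le> z}"
    using swap car measurable_space[OF mU] by auto
  finally show ?thesis ..
qed

text \<open>Both sides agree with the distribution function of \<open>\<bar>y\<bar> \<langle>x, x'\<rangle>\<close> for independent
  \<open>x\<close>, \<open>x'\<close> distributed according to \<open>S\<close> and \<open>S'\<close>.\<close>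

lemma uniform_sphere_halfspace_unique:
  assumes S: "uniform_sphere n S" and S': "uniform_sphere n S'" and y: "y \<in> carrier_vec n"
  shows "emeasure S {x\<in>space S. scalar_prod y x \<le> z} = emeasure S' {x\<in>space S'. scalar_prod y x \<le> z}"
proof -
  interpret S: prob_space S by (rule uniform_sphere_prob[OF S])
  interpret S': prob_space S' by (rule uniform_sphere_prob[OF S'])
  interpret pair_prob_space S S' ..
  have sp: "space S = unit_sphere n" "space S' = unit_sphere n"
    using S S' by (simp_all add: space_uniform_sphere)
  \<comment> \<open>For every unit vector \<open>u\<close> the vector \<open>c u\<close> has the
    norm of \<open>y\<close>, so it may replace \<open>y\<close> as the normal of a half-space under
    either measure.\<close>
  define c where "c = sqrt (scalar_prod y y)"
  have yy: "scalar_prod y y \<ge> 0" using y by (simp add: scalar_prod_sum sum_nonneg)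
  have norm: "scalar_prod (c \<cdot>\<^sub>v u) (c \<cdot>\<^sub>v u) = scalar_prod y y" if "u \<in> unit_sphere n" for u
    using that yy by (auto simp: unit_sphere_def c_def)
  \<comment> \<open>This event is symmetric in the two factors: fixing either component at
    \<open>u\<close> leaves a half-space with normal \<open>c u\<close> for the other.\<close>
  define A where "A = {p \<in> space (S \<Otimes>\<^sub>M S'). c * (\<Sum>i<n. fst p $ i * snd p $ i) \<le> z}"
  have "(\<lambda>p. c * (\<Sum>i<n. fst p $ i * snd p $ i)) \<in> borel_measurable (S \<Otimes>\<^sub>M S')"
    by (intro borel_measurable_sum borel_measurable_times borel_measurable_const
        measurable_compose[OF measurable_fst measurable_uniform_sphere_index[OF S]]
        measurable_compose[OF measurable_snd measurable_uniform_sphere_index[OF S']]) auto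
  then have A: "A \<in> sets (S \<Otimes>\<^sub>M S')" unfolding A_def by measurable
  have sl1: "Pair u -` A = {x\<in>space S'. scalar_prod (c \<cdot>\<^sub>v u) x \<le> z}" if "u \<in> space S" for u
    using that sp by (auto simp: A_def space_pair_measure unit_sphere_def scalar_prod_sum[of _ n] sum_distrib_left mult_ac)
  have sl2: "(\<lambda>x. (x, u)) -` A = {x\<in>space S. scalar_prod (c \<cdot>\<^sub>v u) x \<le> z}" if "u \<in> space S'" for u
    using that sp by (auto simp: A_def space_pair_measure unit_sphere_def scalar_prod_sum[of _ n] sum_distrib_left mult_ac)
  have "emeasure (S \<Otimes>\<^sub>M S') A = (\<integral>\<^sup>+ u. emeasure S' {x\<in>space S'. scalar_prod y x \<le> z} \<partial>S)"
    unfolding S'.emeasure_pair_measure_alt[OF A]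
    using uniform_sphere_halfspace_cong[OF S' _ y norm] sp
    by (intro nn_integral_cong) (auto simp: sl1 unit_sphere_def)
  moreover have "emeasure (S \<Otimes>\<^sub>M S') A = (\<integral>\<^sup>+ u. emeasure S {x\<in>space S. scalar_prod y x \<le> z} \<partial>S')"
    unfolding emeasure_pair_measure_alt2[OF A]
    using uniform_sphere_halfspace_cong[OF S _ y norm] sp
    by (intro nn_integral_cong) (auto simp: sl2 unit_sphere_def)
  ultimately show ?thesis by (simp add: S.emeasure_space_1 S'.emeasure_space_1)
qed

section \<open>Plane rotations\<close>

text \<open>The vector u obtained by applying the transpose of \<open>A\<close> to \<open>x\<close>.
  Only the first \<open>n\<close> rows of \<open>A\<close> are read, so the same expression serves
  an element of \<open>SO m\<close> and its truncation.\<close>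

definition coords :: "nat \<Rightarrow> real mat \<Rightarrow> real vec \<Rightarrow> nat \<Rightarrow> real" where
  "coords n A x j = (\<Sum>i<n. A $$ (i, j) * x $ i)"

definition lin :: "nat \<Rightarrow> nat \<Rightarrow> (nat \<Rightarrow> real) \<Rightarrow> real mat \<Rightarrow> real vec \<Rightarrow> real" where
  "lin n m w A x = (\<Sum>j<m. w j * coords n A x j)"

lemma scalar_prod_mult_eq_lin:
  assumes A: "A \<in> carrier_mat n m" and w: "w \<in> carrier_vec m" and x: "x \<in> carrier_vec n"
  shows "scalar_prod (A *\<^sub>v w) x = lin n m (\<lambda>j. w $ j) A x"
proof -
  have "scalar_prod (A *\<^sub>v w) x = (\<Sum>i<n. (\<Sum>j<m. A $$ (i, j) * w $ j) * x $ i)"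
    unfolding scalar_prod_sum[OF x]
    by (intro sum.cong refl) (use mult_mat_vec_sum[OF A w] in auto)
  also have "\<dots> = (\<Sum>i<n. \<Sum>j<m. w $ j * (A $$ (i, j) * x $ i))"
    by (simp add: sum_distrib_left mult_ac)
  also have "\<dots> = lin n m (\<lambda>j. w $ j) A x"
    unfolding lin_def coords_def sum_distrib_left by (rule sum.swap)
  finally show ?thesis .
qed

text \<open>Right multiplication transforms the coordinate vector linearly and leaves
  \<open>x\<close> alone. This is why right invariance of Haar measure is the useful one for
  anticoncentration.\<close>

lemma coords_mult:
  assumes B: "B \<in> carrier_mat m m" and A: "A \<in> carrier_mat m m" and n: "n \<le> m" and j: "j < m"
  shows "coords n (B * A) x j = (\<Sum>k<m. coords n B x k * A $$ (k, j))"
proof -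
  have "coords n (B * A) x j = (\<Sum>i<n. (\<Sum>k<m. B $$ (i, k) * A $$ (k, j)) * x $ i)"
    unfolding coords_def by (intro sum.cong refl) (use index_mult_mat_sum[OF B A] n j in auto)
  also have "\<dots> = (\<Sum>i<n. \<Sum>k<m. B $$ (i, k) * x $ i * A $$ (k, j))"
    by (simp add: sum_distrib_left mult_ac)
  also have "\<dots> = (\<Sum>k<m. coords n B x k * A $$ (k, j))"
    unfolding coords_def sum_distrib_right by (rule sum.swap)
  finally show ?thesis .
qed

lemma sum_coords_square:
  assumes P: "P \<in> projections n m" and x: "x \<in> unit_sphere n"
  shows "(\<Sum>j<m. (coords n P x j)\<^sup>2) = 1"
proof -
  have Pc: "P \<in> carrier_mat n m" and PP: "P * transpose_mat P = 1\<^sub>m n"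
    using P by (auto simp: projections_def)
  have dl: "(\<Sum>j<m. P $$ (i, j) * P $$ (k, j)) = (if i = k then 1 else 0)" if "i < n" "k < n" for i k
    using index_mult_mat_sum[OF Pc, of "transpose_mat P" n i k] Pc that unfolding PP by auto
  have "(\<Sum>j<m. (coords n P x j)\<^sup>2) = (\<Sum>j<m. \<Sum>i<n. \<Sum>k<n. x $ i * x $ k * (P $$ (i, j) * P $$ (k, j)))"
    unfolding coords_def power2_eq_square sum_product by (simp add: mult_ac)
  also have "\<dots> = (\<Sum>i<n. \<Sum>j<m. \<Sum>k<n. x $ i * x $ k * (P $$ (i, j) * P $$ (k, j)))"
    by (rule sum.swap)
  also have "\<dots> = (\<Sum>i<n. \<Sum>k<n. \<Sum>j<m. x $ i * x $ k * (P $$ (i, j) * P $$ (k, j)))"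
    by (intro sum.cong refl sum.swap)
  also have "\<dots> = (\<Sum>i<n. \<Sum>k<n. if k = i then x $ i * x $ k else 0)"
    unfolding sum_distrib_left[symmetric] by (intro sum.cong refl) (use dl in auto)
  also have "\<dots> = 1" using x by (simp add: unit_sphere_iff)
  finally show ?thesis .
qed

lemma coords_first_rows:
  assumes "A \<in> carrier_mat m m" "j < m"
  shows "coords n (first_rows n A) x j = coords n A x j"
  using assms unfolding coords_def by (intro sum.cong refl) (auto simp: first_rows_def)

lemma first_rows_projections:
  assumes A: "A \<in> SO m" and n: "n \<le> m"
  shows "first_rows n A \<in> projections n m"
proof -
  have Ac: "A \<in> carrier_mat m m" and AA: "A * transpose_mat A = 1\<^sub>m m"
    using A by (auto simp: SO_def orthogonal_mats_def)
  have F: "first_rows n A \<in> carrier_mat n m" using Ac by (simp add: first_rows_def)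
  have "first_rows n A * transpose_mat (first_rows n A) = 1\<^sub>m n"
  proof (rule eq_matI)
    fix i j assume "i < dim_row (1\<^sub>m n :: real mat)" "j < dim_col (1\<^sub>m n :: real mat)"
    then have ij: "i < n" "j < n" by auto
    have "(first_rows n A * transpose_mat (first_rows n A)) $$ (i, j)
        = (\<Sum>l<m. first_rows n A $$ (i, l) * transpose_mat (first_rows n A) $$ (l, j))"
      by (rule index_mult_mat_sum) (use F ij in auto)
    also have "\<dots> = (\<Sum>l<m. A $$ (i, l) * transpose_mat A $$ (l, j))"
      using ij n Ac by (intro sum.cong refl) (auto simp: first_rows_def)
    also have "\<dots> = (A * transpose_mat A) $$ (i, j)"
      using ij n by (subst index_mult_mat_sum[of _ m m _ m]) (use Ac in auto)
    finally show "(first_rows n A * transpose_mat (first_rows n A)) $$ (i, j) = 1\<^sub>m n $$ (i, j)"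
      using ij n unfolding AA by simp
  qed (use F in auto)
  then show ?thesis using F by (simp add: projections_def)
qed

text \<open>A rotation of the \<open>(a, b)\<close>-plane when c^2 + s^2 = 1. The constraint is left
  out so that composition is a polynomial identity in the entries.\<close>

definition rot :: "nat \<Rightarrow> nat \<Rightarrow> nat \<Rightarrow> real \<Rightarrow> real \<Rightarrow> real mat" where
  "rot m a b c s = mat m m (\<lambda>(i, j).
     if i = a \<and> j = a \<or> i = b \<and> j = b then c
     else if i = a \<and> j = b then - s else if i = b \<and> j = a then s
     else if i = j then 1 else 0)"

lemma rot_carrier [simp]: "rot m a b c s \<in> carrier_mat m m"
  by (simp add: rot_def)

lemma rot_dim [simp]: "dim_row (rot m a b c s) = m" "dim_col (rot m a b c s) = m"
  by (simp_all add: rot_def)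

lemma rot_index:
  assumes "i < m" "j < m"
  shows "rot m a b c s $$ (i, j) =
    (if i = a \<and> j = a \<or> i = b \<and> j = b then c
     else if i = a \<and> j = b then - s else if i = b \<and> j = a then s
     else if i = j then 1 else 0)"
  using assms by (simp add: rot_def)

lemma sum_mult_rot:
  assumes ab: "a < m" "b < m" "a \<noteq> b" and j: "j < m"
  shows "(\<Sum>k<m. f k * rot m a b c s $$ (k, j)) =
    (if j = a then c * f a + s * f b else if j = b then c * f b - s * f a else f j)"
proof -
  \<comment> \<open>Column \<open>j\<close> lives in rows \<open>a\<close>, \<open>b\<close> and
    \<open>j\<close>. The third summand is switched off for \<open>j\<close> in
    \<open>{a, b}\<close> to avoid counting that row twice.\<close>
  have "(\<Sum>k<m. f k * rot m a b c s $$ (k, j)) = (\<Sum>k<m. (if k = a then f k * rot m a b c s $$ (a, j) else 0)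
      + (if k = b then f k * rot m a b c s $$ (b, j) else 0)
      + (if k = j then (if j = a \<or> j = b then 0 else f j) else 0))"
    by (intro sum.cong refl) (use ab j in \<open>auto simp: rot_def\<close>)
  also have "\<dots> = f a * rot m a b c s $$ (a, j) + f b * rot m a b c s $$ (b, j) + (if j = a \<or> j = b then 0 else f j)"
    using ab j by (simp add: sum.distrib)
  also have "\<dots> = (if j = a then c * f a + s * f b else if j = b then c * f b - s * f a else f j)"
    using ab j by (auto simp: rot_def)
  finally show ?thesis .
qed

lemma rot_mult:
  assumes ab: "a < m" "b < m" "a \<noteq> b"
  shows "rot m a b c s * rot m a b c' s' = rot m a b (c * c' - s * s') (s * c' + c * s')"
proof (rule eq_matI)
  fix i j assume "i < dim_row (rot m a b (c * c' - s * s') (s * c' + c * s'))"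
    "j < dim_col (rot m a b (c * c' - s * s') (s * c' + c * s'))"
  then have ij: "i < m" "j < m" by (auto simp: rot_def)
  have "(rot m a b c s * rot m a b c' s') $$ (i, j) = (\<Sum>k<m. rot m a b c s $$ (i, k) * rot m a b c' s' $$ (k, j))"
    by (rule index_mult_mat_sum) (use ij in auto)
  also have "\<dots> = rot m a b (c * c' - s * s') (s * c' + c * s') $$ (i, j)"
  proof -
    have ra: "rot m a b c s $$ (i, a) = (if i = a then c else if i = b then s else 0)"
      and rb: "rot m a b c s $$ (i, b) = (if i = a then - s else if i = b then c else 0)"
      using ij ab by (simp_all add: rot_def)
    consider "j = a" | "j = b" | "j \<noteq> a" "j \<noteq> b" by blast
    then show ?thesis
    proof cases
      case 1
      then show ?thesis unfolding sum_mult_rot[OF ab ij(2)] ra rb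
        using ij ab by (simp add: rot_def mult.commute)
    next
      case 2
      then show ?thesis unfolding sum_mult_rot[OF ab ij(2)] ra rb
        using ij ab by (simp add: rot_def mult.commute)
    next
      case 3
      then show ?thesis unfolding sum_mult_rot[OF ab ij(2)]
        using ij ab by (simp add: rot_def)
    qed
  qed
  finally show "(rot m a b c s * rot m a b c' s') $$ (i, j) = rot m a b (c * c' - s * s') (s * c' + c * s') $$ (i, j)" .
qed (auto simp: rot_def)

lemma transpose_rot:
  assumes "a \<noteq> b"
  shows "transpose_mat (rot m a b c s) = rot m a b c (- s)"
proof (rule eq_matI)
  fix i j assume "i < dim_row (rot m a b c (- s))" "j < dim_col (rot m a b c (- s))"
  then have ij: "i < m" "j < m" by simp_all
  then have "transpose_mat (rot m a b c s) $$ (i, j) = rot m a b c s $$ (j, i)" by simp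
  also have "\<dots> = rot m a b c (- s) $$ (i, j)"
    unfolding rot_index[OF ij] rot_index[OF ij(2) ij(1)] using assms
    by (cases "i = a"; cases "i = b"; cases "j = a"; cases "j = b") simp_all
  finally show "transpose_mat (rot m a b c s) $$ (i, j) = rot m a b c (- s) $$ (i, j)" .
qed simp_all

lemma rot_orthogonal:
  assumes ab: "a < m" "b < m" "a \<noteq> b" and cs: "c\<^sup>2 + s\<^sup>2 = 1"
  shows "rot m a b c s \<in> orthogonal_mats m"
proof -
  have I: "rot m a b 1 0 = 1\<^sub>m m"
    by (rule eq_matI) (auto simp: rot_def)
  have 1: "c * c - s * - s = 1" using cs by (simp add: power2_eq_square)
  have 2: "s * c + c * - s = 0" by simp
  have "rot m a b c s * transpose_mat (rot m a b c s) = 1\<^sub>m m"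
    unfolding transpose_rot[OF ab(3)] rot_mult[OF ab] 1 2 by (rule I)
  then show ?thesis by (simp add: orthogonal_mats_def)
qed

text \<open>The determinant is \<open>1\<close> because the rotation is the square of the one by half the angle.\<close>

lemma rot_SO:
  fixes t :: real
  assumes ab: "a < m" "b < m" "a \<noteq> b"
  shows "rot m a b ((1 - t\<^sup>2) / (1 + t\<^sup>2)) (2 * t / (1 + t\<^sup>2)) \<in> SO m"
proof -
  \<comment> \<open>\<open>r\<close> is the length of the vector (1, t), whose direction is the half
    angle; its normalisation \<open>(1 / r, t / r)\<close> gives the rotation to be squared.\<close>
  define r where "r = sqrt (1 + t\<^sup>2)"
  have r: "r * r = 1 + t\<^sup>2" by (simp add: r_def add_nonneg_nonneg)
  have r0: "1 + t\<^sup>2 > 0" by (simp add: add_pos_nonneg)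
  then have r1: "r \<noteq> 0" by (auto simp: r_def)
  have "(1 / r)\<^sup>2 + (t / r)\<^sup>2 = (1 + t\<^sup>2) / (r * r)"
    by (simp add: power_divide add_divide_distrib power2_eq_square)
  also have "\<dots> = 1" using r0 by (simp add: r)
  finally have "rot m a b (1 / r) (t / r) \<in> orthogonal_mats m" by (rule rot_orthogonal[OF ab])
  from orthogonal_square_SO[OF this]
  have "rot m a b (1 / r * (1 / r) - t / r * (t / r)) (t / r * (1 / r) + 1 / r * (t / r)) \<in> SO m"
    unfolding rot_mult[OF ab] .
  moreover have "1 / r * (1 / r) - t / r * (t / r) = (1 - t\<^sup>2) / (1 + t\<^sup>2)"
    unfolding r[symmetric] by (simp add: diff_divide_distrib power2_eq_square)
  moreover have "t / r * (1 / r) + 1 / r * (t / r) = 2 * t / (1 + t\<^sup>2)"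
    unfolding r[symmetric] by simp
  ultimately show ?thesis by (simp only:)
qed


text \<open>Divided differences at integer nodes never amplify the error, since the denominators are
  at least 1. The second one isolates \<open>r\<close>; back substitution then yields
  \<open>q\<close> and \<open>p\<close>.\<close>

lemma quadratic_coeff_bounds:
  fixes p q r d :: real and t1 t2 t3 K :: nat
  assumes distinct: "t1 \<noteq> t2" "t1 \<noteq> t3" "t2 \<noteq> t3" and K: "t1 < K" "t2 < K" "t3 < K"
    and small: "\<And>t :: nat. t \<in> {t1, t2, t3} \<Longrightarrow> \<bar>p + q * real t + r * (real t)\<^sup>2\<bar> \<le> d"
  shows "\<bar>r\<bar> \<le> 4 * d" "\<bar>q\<bar> \<le> 10 * d * K" "\<bar>p\<bar> \<le> 15 * d * (real K)\<^sup>2"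
proof -
  have d: "d \<ge> 0" using small[of t1] by simp
  have K1: "real K \<ge> 1" using K by simp
  have diff: "\<bar>q + r * (real s + t)\<bar> \<le> 2 * d" if "s \<in> {t1, t2, t3}" "t \<in> {t1, t2, t3}" "s \<noteq> t" for s t :: nat
  proof -
    have "1 \<le> \<bar>real s - t\<bar>" using that(3) by linarith
    then have "\<bar>q + r * (real s + t)\<bar> * 1 \<le> \<bar>q + r * (real s + t)\<bar> * \<bar>real s - t\<bar>"
      by (intro mult_left_mono) auto
    also have "\<dots> = \<bar>(p + q * s + r * (real s)\<^sup>2) - (p + q * t + r * (real t)\<^sup>2)\<bar>"
      unfolding abs_mult[symmetric] by (simp add: algebra_simps power2_eq_square)
    also have "\<dots> \<le> 2 * d" using small[OF that(1)] small[OF that(2)] by linarith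
    finally show ?thesis by simp
  qed
  have "1 \<le> \<bar>real t1 - t3\<bar>" using distinct by linarith
  then have "\<bar>r\<bar> * 1 \<le> \<bar>r\<bar> * \<bar>real t1 - t3\<bar>" by (intro mult_left_mono) auto
  also have "\<dots> = \<bar>(q + r * (real t1 + t2)) - (q + r * (real t2 + t3))\<bar>"
    unfolding abs_mult[symmetric] by (simp add: algebra_simps)
  also have "\<dots> \<le> 4 * d" using diff[of t1 t2] diff[of t2 t3] distinct by auto
  finally show r: "\<bar>r\<bar> \<le> 4 * d" by simp
  \<comment> \<open>The remaining constants add up as 2 + 4 * 2 = 10 for \<open>q\<close> and 1 + 10
    + 4 = 15 for \<open>p\<close>, with all powers of \<open>K\<close> raised to the largest
    one.\<close>
  have t: "real t1 + t2 \<le> 2 * real K" "real t1 \<le> K" using K by auto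
  have "\<bar>r * (real t1 + t2)\<bar> \<le> 4 * d * (2 * real K)"
    unfolding abs_mult by (rule mult_mono) (use r t d in auto)
  moreover have "2 * d \<le> 2 * d * K" using K1 d by (simp add: mult_le_cancel_left1)
  ultimately show q: "\<bar>q\<bar> \<le> 10 * d * K" using diff[of t1 t2] distinct by auto
  have "\<bar>q * t1\<bar> \<le> 10 * d * K * K"
    unfolding abs_mult by (rule mult_mono) (use q t d in auto)
  moreover have "\<bar>r * (real t1)\<^sup>2\<bar> \<le> 4 * d * (real K)\<^sup>2"
    unfolding abs_mult by (rule mult_mono) (use r t d in \<open>auto intro: power_mono\<close>)
  moreover have "d \<le> d * (real K)\<^sup>2" using K1 d by (simp add: mult_le_cancel_left1)
  ultimately show "\<bar>p\<bar> \<le> 15 * d * (real K)\<^sup>2" using small[of t1] by (auto simp: power2_eq_square)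
qed


text \<open>Clearing the denominator \<open>1 + t\<^sup>2\<close> turns the strip condition into
  smallness of the quadratic with coefficients \<open>P - y\<close>, \<open>2 * R\<close> and
  \<open>- (P + y)\<close>. Three solutions make all of these small, hence also \<open>P\<close> and
  \<open>R\<close>, whatever \<open>y\<close> is.\<close>

lemma card_rotations_in_strip:
  fixes P R y \<eta> :: real and K :: nat
  assumes PR: "P\<^sup>2 + R\<^sup>2 > 125 * \<eta>\<^sup>2 * real K ^ 8"
  shows "card {t\<in>{..<K}. \<bar>(1 - (real t)\<^sup>2) / (1 + (real t)\<^sup>2) * P + 2 * real t / (1 + (real t)\<^sup>2) * R - y\<bar> \<le> \<eta>} \<le> 2"
    (is "card ?T \<le> 2")
proof (rule ccontr)
  assume "\<not> ?thesis"
  then have "3 \<le> card ?T" by simp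
  then obtain T where T: "T \<subseteq> ?T" "card T = 3" by (rule obtain_subset_with_card_n)
  then obtain t1 t2 t3 where t: "T = {t1, t2, t3}" and dist: "t1 \<noteq> t2" "t1 \<noteq> t3" "t2 \<noteq> t3"
    unfolding card_3_iff by metis
  have K: "t1 < K" "t2 < K" "t3 < K" using T t by auto
  then have K1: "real K \<ge> 1" by simp
  have small: "\<bar>(P - y) + 2 * R * real t + (- (P + y)) * (real t)\<^sup>2\<bar> \<le> \<eta> * (real K)\<^sup>2"
    if "t \<in> {t1, t2, t3}" for t
  proof -
    have tT: "t < K" and le: "\<bar>(1 - (real t)\<^sup>2) / (1 + (real t)\<^sup>2) * P + 2 * real t / (1 + (real t)\<^sup>2) * R - y\<bar> \<le> \<eta>"
      using that T t by auto
    have pos: "1 + (real t)\<^sup>2 > 0" by (simp add: add_pos_nonneg)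
    \<comment> \<open>Strictness of \<open>t < K\<close> gives \<open>t + 1 \<le> K\<close>, so the
      cleared denominator is at most \<open>K\<^sup>2\<close>.\<close>
    have "(real t + 1)\<^sup>2 \<le> (real K)\<^sup>2" using tT by (intro power_mono) auto
    then have tK: "1 + (real t)\<^sup>2 \<le> (real K)\<^sup>2" by (simp add: power2_sum)
    have mult: "(u / D * P + v / D * R - y) * D = u * P + v * R - y * D" if "D \<noteq> 0" for u v D :: real
      using that by (simp add: field_simps)
    have "(P - y) + 2 * R * real t + (- (P + y)) * (real t)\<^sup>2
        = ((1 - (real t)\<^sup>2) / (1 + (real t)\<^sup>2) * P + 2 * real t / (1 + (real t)\<^sup>2) * R - y) * (1 + (real t)\<^sup>2)"
      by (subst mult) (use pos in \<open>auto simp: algebra_simps\<close>)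
    then have "\<bar>(P - y) + 2 * R * real t + (- (P + y)) * (real t)\<^sup>2\<bar>
        = \<bar>(1 - (real t)\<^sup>2) / (1 + (real t)\<^sup>2) * P + 2 * real t / (1 + (real t)\<^sup>2) * R - y\<bar> * (1 + (real t)\<^sup>2)"
      using pos by (simp only: abs_mult)
    also have "\<dots> \<le> \<eta> * (real K)\<^sup>2" using le tK pos by (intro mult_mono) auto
    finally show ?thesis .
  qed
  define d where "d = \<eta> * (real K)\<^sup>2"
  note q = quadratic_coeff_bounds[OF dist K small, folded d_def]
  have d: "0 \<le> d" unfolding d_def using small[of t1] by (rule order_trans[OF abs_ge_zero]) simp
  have d': "d * K \<le> d * (real K)\<^sup>2"
    using K1 d by (intro mult_left_mono) (auto simp: power2_eq_square)
  have d'': "d \<le> d * (real K)\<^sup>2" using K1 d by (simp add: mult_le_cancel_left1)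
  \<comment> \<open>Adding the bounds on \<open>P - y\<close> and \<open>P + y\<close> eliminates
    \<open>y\<close>: \<open>2 * \<bar>P\<bar>\<close> is at most (15 + 4) times
    \<open>d * K\<^sup>2\<close>. The factors 5 and 10 give 25 + 100 = 125 after squaring.\<close>
  have "\<bar>R\<bar> \<le> 5 * (d * (real K)\<^sup>2)" using q(2) d' by linarith
  moreover have "\<bar>P\<bar> \<le> 10 * (d * (real K)\<^sup>2)"
    using q(1) q(3) d'' by linarith
  ultimately have "R\<^sup>2 \<le> (5 * (d * (real K)\<^sup>2))\<^sup>2" "P\<^sup>2 \<le> (10 * (d * (real K)\<^sup>2))\<^sup>2"
    using power_mono[OF _ abs_ge_zero, of R "5 * (d * (real K)\<^sup>2)" 2]
      power_mono[OF _ abs_ge_zero, of P "10 * (d * (real K)\<^sup>2)" 2] by (simp_all only: power2_abs)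
  moreover have "(d * (real K)\<^sup>2)\<^sup>2 = \<eta>\<^sup>2 * real K ^ 8" by (simp add: d_def power_mult_distrib flip: power_mult power_add)
  ultimately have "P\<^sup>2 + R\<^sup>2 \<le> 125 * \<eta>\<^sup>2 * real K ^ 8" by (simp add: power_mult_distrib)
  then show False using PR by simp
qed

section \<open>Anticoncentration of linear forms\<close>

text \<open>Integrate the number of events that contain a point. If \<open>K\<close> such events are
  equally likely, each has probability at most \<open>k / K\<close>.\<close>

lemma (in prob_space) sum_prob_le_multiplicity:
  assumes I: "finite I" and A: "\<And>t. t \<in> I \<Longrightarrow> A t \<in> events"
    and k: "\<And>x. x \<in> space M \<Longrightarrow> card {t\<in>I. x \<in> A t} \<le> k"
  shows "(\<Sum>t\<in>I. prob (A t)) \<le> real k"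
proof -
  have int: "integrable M (\<lambda>x. indicator (A t) x :: real)" if "t \<in> I" for t
    using A[OF that] by (simp add: emeasure_eq_measure)
  have "(\<Sum>t\<in>I. prob (A t)) = (\<Sum>t\<in>I. expectation (indicator (A t)))"
    by (intro sum.cong refl) (use A in auto)
  also have "\<dots> = expectation (\<lambda>x. \<Sum>t\<in>I. indicator (A t) x)"
    using int by (subst Bochner_Integration.integral_sum) auto
  also have "\<dots> \<le> expectation (\<lambda>x. real k)"
  proof (rule integral_mono)
    fix x assume "x \<in> space M"
    have "(\<Sum>t\<in>I. indicator (A t) x :: real) = card {t\<in>I. x \<in> A t}"
      using I by (simp add: indicator_def sum.If_cases Int_def)
    then show "(\<Sum>t\<in>I. indicator (A t) x) \<le> real k" using k[OF \<open>x \<in> space M\<close>] by simp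
  qed (use int in auto)
  finally show ?thesis by (simp add: prob_space)
qed

section \<open>Measurability and right invariance on the product of Haar and sphere measure\<close>

lemma measurable_coords:
  assumes S: "uniform_sphere n S" and N: "\<And>i. i < n \<Longrightarrow> (\<lambda>A. A $$ (i, j)) \<in> borel_measurable N"
  shows "(\<lambda>p. coords n (fst p) (snd p) j) \<in> borel_measurable (N \<Otimes>\<^sub>M S)"
  unfolding coords_def
  by (intro borel_measurable_sum borel_measurable_times
      measurable_compose[OF measurable_fst N]
      measurable_compose[OF measurable_snd measurable_uniform_sphere_index[OF S]]) auto

lemma measurable_lin:
  assumes S: "uniform_sphere n S"
    and N: "\<And>i j. i < n \<Longrightarrow> j < m \<Longrightarrow> (\<lambda>A. A $$ (i, j)) \<in> borel_measurable N"
  shows "(\<lambda>p. lin n m w (fst p) (snd p)) \<in> borel_measurable (N \<Otimes>\<^sub>M S)"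
  unfolding lin_def
  by (intro borel_measurable_sum borel_measurable_times borel_measurable_const measurable_coords[OF S] N) auto

lemma distr_haar_SO_right_mult:
  assumes H: "haar_SO m H" and S: "uniform_sphere n S" and A: "A \<in> SO m"
  shows "(\<lambda>p. (fst p * A, snd p)) \<in> measurable (H \<Otimes>\<^sub>M S) (H \<Otimes>\<^sub>M S)" (is ?m)
    and "distr (H \<Otimes>\<^sub>M S) (H \<Otimes>\<^sub>M S) (\<lambda>p. (fst p * A, snd p)) = H \<Otimes>\<^sub>M S" (is ?d)
proof -
  interpret H: prob_space H by (rule haar_SO_prob[OF H])
  interpret S: prob_space S by (rule uniform_sphere_prob[OF S])
  have AH: "A \<in> space H" using A H by (simp add: space_haar_SO)
  have R: "(\<lambda>B. B * A) \<in> measurable H H"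
    using measurable_compose[OF measurable_Pair2'[OF AH, of H] measurable_haar_SO_mult[OF H H]] by simp
  show ?m
    by (intro measurable_Pair measurable_compose[OF measurable_fst R] measurable_snd)
  have dS: "distr S S (\<lambda>x. x) = S" by (rule distr_id)
  have dH: "distr H H (\<lambda>B. B * A) = H" using H A by (simp add: haar_SO_def)
  have "distr (H \<Otimes>\<^sub>M S) (H \<Otimes>\<^sub>M S) (\<lambda>(B, x). (B * A, x)) = distr H H (\<lambda>B. B * A) \<Otimes>\<^sub>M distr S S (\<lambda>x. x)"
    by (rule pair_measure_distr[symmetric, OF R]) (auto simp: dS S.sigma_finite_measure_axioms)
  then show ?d by (simp add: dS dH case_prod_beta')
qed

lemma measure_haar_SO_right_mult:
  assumes H: "haar_SO m H" and S: "uniform_sphere n S" and A: "A \<in> SO m"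
    and X: "X \<in> sets (H \<Otimes>\<^sub>M S)"
  shows "measure (H \<Otimes>\<^sub>M S) {p \<in> space (H \<Otimes>\<^sub>M S). (fst p * A, snd p) \<in> X} = measure (H \<Otimes>\<^sub>M S) X"
    and "{p \<in> space (H \<Otimes>\<^sub>M S). (fst p * A, snd p) \<in> X} \<in> sets (H \<Otimes>\<^sub>M S)"
proof -
  have eq: "{p \<in> space (H \<Otimes>\<^sub>M S). (fst p * A, snd p) \<in> X} = (\<lambda>p. (fst p * A, snd p)) -` X \<inter> space (H \<Otimes>\<^sub>M S)"
    by auto
  show "{p \<in> space (H \<Otimes>\<^sub>M S). (fst p * A, snd p) \<in> X} \<in> sets (H \<Otimes>\<^sub>M S)"
    unfolding eq by (rule measurable_sets[OF distr_haar_SO_right_mult(1)[OF H S A] X])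
  have "measure (distr (H \<Otimes>\<^sub>M S) (H \<Otimes>\<^sub>M S) (\<lambda>p. (fst p * A, snd p))) X
      = measure (H \<Otimes>\<^sub>M S) ((\<lambda>p. (fst p * A, snd p)) -` X \<inter> space (H \<Otimes>\<^sub>M S))"
    by (rule measure_distr[OF distr_haar_SO_right_mult(1)[OF H S A] X])
  then show "measure (H \<Otimes>\<^sub>M S) {p \<in> space (H \<Otimes>\<^sub>M S). (fst p * A, snd p) \<in> X} = measure (H \<Otimes>\<^sub>M S) X"
    unfolding distr_haar_SO_right_mult(2)[OF H S A] eq ..
qed

lemma coords_mult_rot:
  assumes B: "B \<in> carrier_mat m m" and n: "n \<le> m" and ab: "a < m" "b < m" "a \<noteq> b" and j: "j < m"
  shows "coords n (B * rot m a b c s) x j =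
    (if j = a then c * coords n B x a + s * coords n B x b
     else if j = b then c * coords n B x b - s * coords n B x a else coords n B x j)"
  unfolding coords_mult[OF B rot_carrier n j] by (rule sum_mult_rot[OF ab j])

lemma sum_split_two:
  fixes f :: "nat \<Rightarrow> real"
  assumes "a < m" "b < m" "a \<noteq> b"
  shows "(\<Sum>j<m. f j) = f a + f b + (\<Sum>j\<in>{..<m} - {a, b}. f j)"
proof -
  have "(\<Sum>j<m. f j) = (\<Sum>j\<in>{a, b}. f j) + (\<Sum>j\<in>{..<m} - {a, b}. f j)"
    using assms by (subst sum.subset_diff[of "{a, b}"]) auto
  then show ?thesis using assms by simp
qed

text \<open>Only the two plane coordinates move. The coefficients of \<open>c\<close> and
  \<open>s\<close> are the inner product and the signed area of the plane parts of \<open>w\<close>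
  and u, so by Lagrange's identity their squares sum to the product of the squared lengths.\<close>

lemma lin_mult_rot:
  assumes B: "B \<in> carrier_mat m m" and n: "n \<le> m" and ab: "a < m" "b < m" "a \<noteq> b"
  shows "lin n m w (B * rot m a b c s) x =
    c * (w a * coords n B x a + w b * coords n B x b) + s * (w a * coords n B x b - w b * coords n B x a)
    + (\<Sum>j\<in>{..<m} - {a, b}. w j * coords n B x j)"
proof -
  have "lin n m w (B * rot m a b c s) x = w a * coords n (B * rot m a b c s) x a
     + w b * coords n (B * rot m a b c s) x b
     + (\<Sum>j\<in>{..<m} - {a, b}. w j * coords n (B * rot m a b c s) x j)"
    unfolding lin_def by (rule sum_split_two[OF ab])
  also have "(\<Sum>j\<in>{..<m} - {a, b}. w j * coords n (B * rot m a b c s) x j)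
      = (\<Sum>j\<in>{..<m} - {a, b}. w j * coords n B x j)"
    by (intro sum.cong refl) (use coords_mult_rot[OF B n ab] in auto)
  finally show ?thesis
    using coords_mult_rot[OF B n ab ab(1), of c s x] coords_mult_rot[OF B n ab ab(2), of c s x] ab
    by (simp add: algebra_simps)
qed

text \<open>The event is carried to itself by the rotations of the \<open>(a, b)\<close>-plane, except that the
  value of the linear form varies; few of \<open>K\<close> rotations put it into the strip.\<close>

lemma prob_strip_plane:
  assumes H: "haar_SO m H" and S: "uniform_sphere n S" and n: "n \<le> m"
    and ab: "a < m" "b < m" "a \<noteq> b" and w: "\<bar>w a\<bar> \<ge> 1"
    and K: "K \<ge> 1" and \<eta>: "125 * \<eta>\<^sup>2 * real K ^ 8 < \<delta>"
  shows "measure (H \<Otimes>\<^sub>M S) {p \<in> space (H \<Otimes>\<^sub>M S). \<bar>lin n m w (fst p) (snd p) - z\<bar> \<le> \<eta> \<and>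
      \<delta> \<le> (coords n (fst p) (snd p) a)\<^sup>2 + (coords n (fst p) (snd p) b)\<^sup>2} \<le> 2 / K"
    (is "measure _ ?X \<le> _")
proof -
  interpret H: prob_space H by (rule haar_SO_prob[OF H])
  interpret S: prob_space S by (rule uniform_sphere_prob[OF S])
  interpret pair_prob_space H S ..
  have [measurable]: "(\<lambda>p. lin n m w (fst p) (snd p)) \<in> borel_measurable (H \<Otimes>\<^sub>M S)"
    by (rule measurable_lin[OF S measurable_haar_SO_index[OF H]]) (use n in auto)
  have [measurable]: "(\<lambda>p. coords n (fst p) (snd p) j) \<in> borel_measurable (H \<Otimes>\<^sub>M S)" if "j < m" for j
    by (rule measurable_coords[OF S measurable_haar_SO_index[OF H]]) (use n that in auto)
  note [measurable] = this[OF ab(1)] this[OF ab(2)]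
  have X: "?X \<in> sets (H \<Otimes>\<^sub>M S)" by measurable
  define A where "A t = rot m a b ((1 - (real t)\<^sup>2) / (1 + (real t)\<^sup>2)) (2 * real t / (1 + (real t)\<^sup>2))" for t :: nat
  have A: "A t \<in> SO m" for t unfolding A_def by (rule rot_SO[OF ab])
  define Y where "Y t = {p \<in> space (H \<Otimes>\<^sub>M S). (fst p * A t, snd p) \<in> ?X}" for t
  have Y: "Y t \<in> sets (H \<Otimes>\<^sub>M S)" "measure (H \<Otimes>\<^sub>M S) (Y t) = measure (H \<Otimes>\<^sub>M S) ?X" for t
    unfolding Y_def using measure_haar_SO_right_mult[OF H S A X] by auto
  have "real K * measure (H \<Otimes>\<^sub>M S) ?X = (\<Sum>t<K. measure (H \<Otimes>\<^sub>M S) (Y t))"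
    by (simp add: Y)
  also have "\<dots> \<le> real 2"
  proof (rule sum_prob_le_multiplicity)
    fix p assume p: "p \<in> space (H \<Otimes>\<^sub>M S)"
    define u where "u = coords n (fst p) (snd p)"
    have B: "fst p \<in> carrier_mat m m"
      using p H SO_carrier by (auto simp: space_pair_measure space_haar_SO)
    define P where "P = w a * u a + w b * u b"
    define R where "R = w a * u b - w b * u a"
    define r where "r = (\<Sum>j\<in>{..<m} - {a, b}. w j * u j)"
    let ?c = "\<lambda>t::nat. (1 - (real t)\<^sup>2) / (1 + (real t)\<^sup>2)"
    let ?s = "\<lambda>t::nat. 2 * real t / (1 + (real t)\<^sup>2)"
    let ?T = "{t\<in>{..<K}. \<bar>?c t * P + ?s t * R - (z - r)\<bar> \<le> \<eta>}"
    have cs: "(?c t)\<^sup>2 + (?s t)\<^sup>2 = 1" for t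
    proof -
      have "1 + (real t)\<^sup>2 \<noteq> 0" by (metis add_nonneg_eq_0_iff zero_le_one zero_le_power2 zero_neq_one)
      moreover have "(1 - (real t)\<^sup>2)\<^sup>2 + (2 * real t)\<^sup>2 = (1 + (real t)\<^sup>2)\<^sup>2"
        by (simp add: power2_eq_square algebra_simps)
      ultimately show ?thesis by (simp add: power_divide flip: add_divide_distrib)
    qed
    have rot_norm: "(c * x + s * y)\<^sup>2 + (c * y - s * x)\<^sup>2 = (c\<^sup>2 + s\<^sup>2) * (x\<^sup>2 + y\<^sup>2)" for c s x y :: real
      by (simp add: power2_eq_square algebra_simps)
    \<comment> \<open>The rotation preserves the length of the plane part of u. The second condition
      of the event therefore does not depend on \<open>t\<close>, and only the strip condition has
      to be counted.\<close>
    have sub: "t \<in> ?T \<and> \<delta> \<le> (u a)\<^sup>2 + (u b)\<^sup>2" if "t < K" "p \<in> Y t" for t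
    proof -
      have 1: "\<bar>lin n m w (fst p * A t) (snd p) - z\<bar> \<le> \<eta>"
        and 2: "\<delta> \<le> (coords n (fst p * A t) (snd p) a)\<^sup>2 + (coords n (fst p * A t) (snd p) b)\<^sup>2"
        using that(2) by (auto simp: Y_def)
      have "(coords n (fst p * A t) (snd p) a)\<^sup>2 + (coords n (fst p * A t) (snd p) b)\<^sup>2
          = (?c t * u a + ?s t * u b)\<^sup>2 + (?c t * u b - ?s t * u a)\<^sup>2"
        unfolding A_def coords_mult_rot[OF B n ab ab(1)] coords_mult_rot[OF B n ab ab(2)] u_def
        using ab by simp
      also have "\<dots> = ((?c t)\<^sup>2 + (?s t)\<^sup>2) * ((u a)\<^sup>2 + (u b)\<^sup>2)"
        by (rule rot_norm)
      finally have "\<delta> \<le> (u a)\<^sup>2 + (u b)\<^sup>2" using 2 unfolding cs by simp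
      moreover have "lin n m w (fst p * A t) (snd p) - z = ?c t * P + ?s t * R - (z - r)"
        unfolding A_def lin_mult_rot[OF B n ab] P_def R_def r_def u_def by simp
      ultimately show ?thesis using 1 that(1) by simp
    qed
    show "card {t\<in>{..<K}. p \<in> Y t} \<le> 2"
    proof (cases "\<delta> \<le> (u a)\<^sup>2 + (u b)\<^sup>2")
      case True
      have "1\<^sup>2 \<le> \<bar>w a\<bar>\<^sup>2" by (rule power_mono) (use w in auto)
      then have "1 \<le> (w a)\<^sup>2 + (w b)\<^sup>2" by (simp add: add_increasing2)
      then have "1 * ((u a)\<^sup>2 + (u b)\<^sup>2) \<le> ((w a)\<^sup>2 + (w b)\<^sup>2) * ((u a)\<^sup>2 + (u b)\<^sup>2)"
        by (intro mult_right_mono) auto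
      \<comment> \<open>Lagrange's identity; together with \<open>\<bar>w a\<bar> \<ge> 1\<close> it
        turns the lower bound on the plane part of u into one on
        \<open>P\<^sup>2 + R\<^sup>2\<close>. If that lower bound fails, no rotated copy of the
        event contains \<open>p\<close>.\<close>
      also have "\<dots> = P\<^sup>2 + R\<^sup>2" unfolding P_def R_def by (simp add: power2_eq_square algebra_simps)
      finally have "(u a)\<^sup>2 + (u b)\<^sup>2 \<le> P\<^sup>2 + R\<^sup>2" by simp
      then have "125 * \<eta>\<^sup>2 * real K ^ 8 < P\<^sup>2 + R\<^sup>2"
        using less_le_trans[OF \<eta> True] by (rule less_le_trans[rotated])
      then have "card ?T \<le> 2" by (rule card_rotations_in_strip)
      moreover have "card {t\<in>{..<K}. p \<in> Y t} \<le> card ?T"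
        by (intro card_mono) (use sub in auto)
      ultimately show ?thesis by linarith
    next
      case False
      then have eq: "{t\<in>{..<K}. p \<in> Y t} = {}" using sub by auto
      show ?thesis unfolding eq by simp
    qed
  qed (use Y in auto)
  finally show ?thesis using K by (simp add: field_simps)
qed

text \<open>A unit vector with \<open>m\<close> coordinates has one whose square is at least
  \<open>1 / m\<close>. That coordinate depends on the sample point, whence the union over all
  planes containing direction \<open>a\<close> and the loss of a factor \<open>m\<close>.\<close>

lemma prob_strip_le:
  assumes H: "haar_SO m H" and S: "uniform_sphere n S" and n: "n \<le> m" and m: "m \<ge> 2"
    and a: "a < m" "\<bar>w a\<bar> \<ge> 1" and K: "K \<ge> 1" and \<eta>: "12 * real m * real K ^ 4 * \<eta> \<le> 1" "\<eta> \<ge> 0"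
  shows "measure (H \<Otimes>\<^sub>M S) {p \<in> space (H \<Otimes>\<^sub>M S). \<bar>lin n m w (fst p) (snd p) - z\<bar> \<le> \<eta>} \<le> 2 * real m / K"
    (is "measure _ ?X \<le> _")
proof -
  interpret H: prob_space H by (rule haar_SO_prob[OF H])
  interpret S: prob_space S by (rule uniform_sphere_prob[OF S])
  interpret pair_prob_space H S ..
  let ?N = "H \<Otimes>\<^sub>M S"
  define G where "G b = {p \<in> space ?N. \<bar>lin n m w (fst p) (snd p) - z\<bar> \<le> \<eta> \<and>
      1 / m \<le> (coords n (fst p) (snd p) a)\<^sup>2 + (coords n (fst p) (snd p) b)\<^sup>2}" for b
  have lm: "(\<lambda>p. lin n m w (fst p) (snd p)) \<in> borel_measurable ?N"
    by (rule measurable_lin[OF S measurable_haar_SO_index[OF H]]) (use n in auto)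
  have cm: "(\<lambda>p. coords n (fst p) (snd p) j) \<in> borel_measurable ?N" if "j < m" for j
    by (rule measurable_coords[OF S measurable_haar_SO_index[OF H]]) (use n that in auto)
  have G: "G b \<in> sets ?N" if "b < m" for b
  proof -
    note [measurable] = lm cm[OF a(1)] cm[OF that]
    show ?thesis unfolding G_def by measurable
  qed
  have small: "125 * \<eta>\<^sup>2 * real K ^ 8 < 1 / m"
  proof -
    \<comment> \<open>Squaring the hypothesis gives 144 in place of the required 125, which makes
      the inequality strict.\<close>
    have "(12 * real m * real K ^ 4 * \<eta>)\<^sup>2 \<le> 1" using \<eta> by (simp add: power_le_one)
    then have *: "144 * real m * (real m * (\<eta>\<^sup>2 * real K ^ 8)) \<le> 1"
      by (simp add: power_mult_distrib power2_eq_square mult_ac flip: power_mult power_add)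
    have "144 * (real m * (\<eta>\<^sup>2 * real K ^ 8)) \<le> 144 * real m * (real m * (\<eta>\<^sup>2 * real K ^ 8))"
      using m by (intro mult_right_mono) auto
    with * have "144 * (real m * (\<eta>\<^sup>2 * real K ^ 8)) \<le> 1" by linarith
    moreover have "real m * (\<eta>\<^sup>2 * real K ^ 8) \<ge> 0" by simp
    ultimately have "125 * (real m * (\<eta>\<^sup>2 * real K ^ 8)) < 1" by linarith
    then show ?thesis using m by (simp add: field_simps)
  qed
  have "?X \<subseteq> (\<Union>b\<in>{..<m} - {a}. G b)"
  proof
    fix p assume p: "p \<in> ?X"
    have "first_rows n (fst p) \<in> projections n m" "snd p \<in> unit_sphere n" "fst p \<in> carrier_mat m m"
      using p H S SO_carrier first_rows_projections[OF _ n]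
      by (auto simp: space_pair_measure space_haar_SO space_uniform_sphere)
    then have sum: "(\<Sum>j<m. (coords n (fst p) (snd p) j)\<^sup>2) = 1"
      using sum_coords_square[of "first_rows n (fst p)" n m "snd p"] by (simp add: coords_first_rows)
    have "\<exists>b<m. 1 / m \<le> (coords n (fst p) (snd p) b)\<^sup>2"
    proof (rule ccontr)
      assume "\<not> ?thesis"
      then have "(\<Sum>j<m. (coords n (fst p) (snd p) j)\<^sup>2) < (\<Sum>j<m. 1 / m)"
        using m by (intro sum_strict_mono) (auto simp: lessThan_empty_iff not_le)
      then show False using sum m by simp
    qed
    then obtain b where b: "b < m" "1 / m \<le> (coords n (fst p) (snd p) b)\<^sup>2" by blast
    \<comment> \<open>If the heavy coordinate is \<open>a\<close> itself, any other index completes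
      the plane; one exists because \<open>m \<ge> 2\<close>.\<close>
    obtain b' where b': "b' < m" "b' \<noteq> a" "b \<noteq> a \<longrightarrow> b' = b"
    proof (cases "b = a")
      case True
      then show thesis using that[of "if a = 0 then 1 else 0"] m by auto
    qed (use that b in auto)
    have "1 / m \<le> (coords n (fst p) (snd p) a)\<^sup>2 + (coords n (fst p) (snd p) b')\<^sup>2"
      using b b' by (cases "b = a") (auto intro: add_increasing add_increasing2)
    then show "p \<in> (\<Union>b\<in>{..<m} - {a}. G b)" using p b' by (auto simp: G_def)
  qed
  then have "measure ?N ?X \<le> measure ?N (\<Union>b\<in>{..<m} - {a}. G b)"
    by (rule finite_measure_mono) (use G in auto)
  also have "\<dots> \<le> (\<Sum>b\<in>{..<m} - {a}. measure ?N (G b))"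
    by (rule finite_measure_subadditive_finite) (use G in auto)
  also have "\<dots> \<le> (\<Sum>b\<in>{..<m} - {a}. 2 / K)"
    unfolding G_def by (intro sum_mono prob_strip_plane[where w = w and a = a, OF H S n a(1) _ _ a(2) K small]) auto
  also have "\<dots> \<le> (\<Sum>b<m. 2 / K)" by (rule sum_mono2) auto
  finally show ?thesis by (simp add: mult.commute)
qed

section \<open>Distribution functions\<close>

lemma projection_space_props:
  "space (projection_space n m) = projections n m"
  "i < n \<Longrightarrow> j < m \<Longrightarrow> (\<lambda>A. A $$ (i, j)) \<in> borel_measurable (projection_space n m)"
  by (auto simp: projection_space_def space_restrict_space projections_def
      intro: measurable_restrict_space1 measurable_mat_index)

lemma projection_space_index_cong:
  assumes "sets N = sets (projection_space n m)" "i < n" "j < m"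
  shows "(\<lambda>A. A $$ (i, j)) \<in> borel_measurable N"
  using projection_space_props(2)[OF assms(2,3)] measurable_cong_sets[OF assms(1) refl] by blast

text \<open>The conditional distribution function given the projection: a test with values in [0, 1]
  that depends on \<open>P\<close> alone, as the sampling lemma requires.\<close>

definition slice_cdf :: "nat \<Rightarrow> nat \<Rightarrow> real vec measure \<Rightarrow> (nat \<Rightarrow> real) \<Rightarrow> real \<Rightarrow> real mat \<Rightarrow> real" where
  "slice_cdf n m S w z P = measure S {x \<in> space S. lin n m w P x \<le> z}"

lemma sets_lin_le:
  assumes S: "uniform_sphere n S"
  shows "{x \<in> space S. lin n m w P x \<le> z} \<in> sets S"
proof -
  have [measurable]: "(\<lambda>x. lin n m w P x) \<in> borel_measurable S"
    unfolding lin_def coords_def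
    by (intro borel_measurable_sum borel_measurable_times borel_measurable_const
        measurable_uniform_sphere_index[OF S]) auto
  show ?thesis by measurable
qed

text \<open>Fubini. Asking only for measurable entries lets \<open>N\<close> be a law of projections
  as well as Haar measure on square matrices.\<close>

lemma measure_pair_lin_le:
  assumes N: "prob_space N" and S: "uniform_sphere n S"
    and idx: "\<And>i j. i < n \<Longrightarrow> j < m \<Longrightarrow> (\<lambda>A. A $$ (i, j)) \<in> borel_measurable N"
  shows "slice_cdf n m S w z \<in> borel_measurable N"
    and "measure (N \<Otimes>\<^sub>M S) {p \<in> space (N \<Otimes>\<^sub>M S). lin n m w (fst p) (snd p) \<le> z}
      = (\<integral>P. slice_cdf n m S w z P \<partial>N)"
proof -
  interpret N: prob_space N by (rule N)
  interpret S: prob_space S by (rule uniform_sphere_prob[OF S])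
  interpret pair_prob_space N S ..
  let ?A = "{p \<in> space (N \<Otimes>\<^sub>M S). lin n m w (fst p) (snd p) \<le> z}"
  have [measurable]: "(\<lambda>p. lin n m w (fst p) (snd p)) \<in> borel_measurable (N \<Otimes>\<^sub>M S)"
    by (rule measurable_lin[OF S idx])
  have A: "?A \<in> sets (N \<Otimes>\<^sub>M S)" by measurable
  have sl: "emeasure S (Pair P -` ?A) = ennreal (slice_cdf n m S w z P)" if "P \<in> space N" for P
  proof -
    have "Pair P -` ?A = {x \<in> space S. lin n m w P x \<le> z}"
      using that by (auto simp: space_pair_measure)
    then show ?thesis by (simp add: slice_cdf_def S.emeasure_eq_measure)
  qed
  have "(\<lambda>P. measure S (Pair P -` ?A)) \<in> borel_measurable N"
    using S.measurable_emeasure_Pair[OF A] unfolding measure_def by measurable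
  moreover have "measure S (Pair P -` ?A) = slice_cdf n m S w z P" if "P \<in> space N" for P
    using sl[OF that] by (simp add: measure_def slice_cdf_def)
  ultimately show m: "slice_cdf n m S w z \<in> borel_measurable N"
    by (rule measurable_cong[THEN iffD1, rotated])
  have int: "integrable N (slice_cdf n m S w z)"
    by (rule N.integrable_const_bound[where B = 1]) (use m in \<open>auto simp: slice_cdf_def\<close>)
  have "ennreal (measure (N \<Otimes>\<^sub>M S) ?A) = (\<integral>\<^sup>+P. ennreal (slice_cdf n m S w z P) \<partial>N)"
    unfolding emeasure_eq_measure[symmetric] S.emeasure_pair_measure_alt[OF A]
    by (intro nn_integral_cong sl)
  also have "\<dots> = ennreal (\<integral>P. slice_cdf n m S w z P \<partial>N)"
    by (rule nn_integral_eq_integral[OF int]) (simp add: slice_cdf_def)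
  finally show "measure (N \<Otimes>\<^sub>M S) ?A = (\<integral>P. slice_cdf n m S w z P \<partial>N)"
    by (simp add: integral_nonneg_AE slice_cdf_def)
qed

lemma slice_cdf_bounds: "prob_space S \<Longrightarrow> slice_cdf n m S w z P \<in> {0..1}"
  by (simp add: slice_cdf_def prob_space.prob_le_1)

lemma abs_coords_le_1:
  assumes "P \<in> projections n m" "x \<in> unit_sphere n" "j < m"
  shows "\<bar>coords n P x j\<bar> \<le> 1"
proof -
  have "(coords n P x j)\<^sup>2 \<le> (\<Sum>j<m. (coords n P x j)\<^sup>2)"
    by (rule member_le_sum) (use assms in auto)
  then show ?thesis using sum_coords_square[OF assms(1,2)] by (simp add: abs_square_le_1)
qed

text \<open>Each coordinate of a unit vector is at most 1 in absolute value. Cauchy-Schwarz would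
  give sqrt m in place of \<open>m\<close>, which affects the seed length by a constant factor at
  most.\<close>

lemma abs_lin_diff_le:
  assumes P: "P \<in> projections n m" and x: "x \<in> unit_sphere n"
    and d: "\<And>j. j < m \<Longrightarrow> \<bar>w j - w' j\<bar> \<le> d"
  shows "\<bar>lin n m w P x - lin n m w' P x\<bar> \<le> real m * d"
proof -
  have "lin n m w P x - lin n m w' P x = (\<Sum>j<m. (w j - w' j) * coords n P x j)"
    unfolding lin_def by (simp add: left_diff_distrib sum_subtractf)
  also have "\<bar>\<dots>\<bar> \<le> (\<Sum>j<m. d)"
  proof (rule order_trans[OF sum_abs], intro sum_mono)
    fix j assume "j \<in> {..<m}"
    then have j: "j < m" by simp
    have "\<bar>w j - w' j\<bar> * \<bar>coords n P x j\<bar> \<le> d * 1"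
      by (rule mult_mono) (use d[OF j] abs_coords_le_1[OF P x j] in auto)
    then show "\<bar>(w j - w' j) * coords n P x j\<bar> \<le> d" by (simp add: abs_mult)
  qed
  finally show ?thesis by simp
qed

text \<open>Raising the threshold by \<open>m * d\<close> pays for moving \<open>w\<close> by
  \<open>d\<close> in each entry. Used in both directions, this sandwiches a distribution function
  between rounded ones without any continuity.\<close>

lemma slice_cdf_mono:
  assumes S: "uniform_sphere n S" and P: "P \<in> projections n m"
    and d: "\<And>j. j < m \<Longrightarrow> \<bar>w j - w' j\<bar> \<le> d" and z: "z + real m * d \<le> z'"
  shows "slice_cdf n m S w z P \<le> slice_cdf n m S w' z' P"
proof -
  interpret S: prob_space S by (rule uniform_sphere_prob[OF S])
  have "{x \<in> space S. lin n m w P x \<le> z} \<subseteq> {x \<in> space S. lin n m w' P x \<le> z'}"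
  proof
    fix x assume x: "x \<in> {x \<in> space S. lin n m w P x \<le> z}"
    then have "x \<in> unit_sphere n" using S by (simp add: space_uniform_sphere)
    from abs_lin_diff_le[OF P this, of w w' d] d x z
    show "x \<in> {x \<in> space S. lin n m w' P x \<le> z'}" by auto
  qed
  then show ?thesis unfolding slice_cdf_def
    by (rule S.finite_measure_mono) (rule sets_lin_le[OF S])
qed

text \<open>Confines the thresholds to \<open>\<bar>z\<bar> \<le> m\<close>, so that finitely many
  rounded ones remain.\<close>

lemma slice_cdf_extreme:
  assumes S: "uniform_sphere n S" and P: "P \<in> projections n m"
    and w: "\<And>j. j < m \<Longrightarrow> \<bar>w j\<bar> \<le> 1" and z: "\<bar>z\<bar> > m"
  shows "slice_cdf n m S w z P = (if z > 0 then 1 else 0)"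
proof -
  interpret S: prob_space S by (rule uniform_sphere_prob[OF S])
  have b: "\<bar>lin n m w P x\<bar> \<le> m" if "x \<in> space S" for x
  proof -
    have "x \<in> unit_sphere n" using S that by (simp add: space_uniform_sphere)
    from abs_lin_diff_le[OF P this, of w "\<lambda>_. 0" 1] w show ?thesis by (simp add: lin_def)
  qed
  have "{x \<in> space S. lin n m w P x \<le> z} = (if z > 0 then space S else {})"
    using b z by (auto split: if_splits) (fastforce, smt (verit))
  then show ?thesis by (simp add: slice_cdf_def S.prob_space)
qed

lemma slice_cdf_scale:
  assumes "s > 0"
  shows "slice_cdf n m S w z P = slice_cdf n m S (\<lambda>j. w j / s) (z / s) P"
proof -
  have "lin n m (\<lambda>j. w j / s) P x = lin n m w P x / s" for x
    by (simp add: lin_def sum_divide_distrib)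
  then show ?thesis using assms by (simp add: slice_cdf_def divide_le_cancel)
qed

lemma slice_cdf_zero:
  assumes S: "prob_space S" and w: "\<And>j. j < m \<Longrightarrow> w j = 0"
  shows "slice_cdf n m S w z P = (if 0 \<le> z then 1 else 0)"
  using prob_space.prob_space[OF S] by (simp add: slice_cdf_def lin_def w)

text \<open>As a function of \<open>x\<close>, the form is the scalar product with the fixed vector
  \<open>P w\<close>, so the event is a half-space, and half-space probabilities are unique.\<close>

lemma slice_cdf_sphere_unique:
  assumes S: "uniform_sphere n S" and S': "uniform_sphere n S'" and P: "P \<in> carrier_mat n m"
  shows "slice_cdf n m S w z P = slice_cdf n m S' w z P"
proof -
  let ?y = "P *\<^sub>v vec m w"
  have y: "?y \<in> carrier_vec n" using P by simp
  have lin: "lin n m w P x = scalar_prod ?y x" if "x \<in> carrier_vec n" for x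
    using scalar_prod_mult_eq_lin[OF P _ that, of "vec m w"] by (simp add: lin_def)
  have set: "{x \<in> space U. lin n m w P x \<le> z} = {x \<in> space U. scalar_prod ?y x \<le> z}"
    if "uniform_sphere n U" for U
    using lin space_uniform_sphere[OF that] by (auto simp: unit_sphere_def)
  show ?thesis
    unfolding slice_cdf_def measure_def set[OF S] set[OF S']
    by (simp add: uniform_sphere_halfspace_unique[OF S S' y])
qed

section \<open>Haar averages of the conditional distribution functions\<close>

lemma first_rows_measurable:
  assumes H: "haar_SO m H" and n: "n \<le> m"
  shows "first_rows n \<in> measurable H (projection_space n m)"
  unfolding projection_space_def
proof (intro measurable_restrict_space2 measurable_mat_borelI)
  show "first_rows n \<in> space H \<rightarrow> projections n m"
    using first_rows_projections n H by (auto simp: space_haar_SO)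
  fix A assume "A \<in> space H"
  then show "first_rows n A \<in> carrier_mat n m"
    using first_rows_projections n H by (auto simp: space_haar_SO projections_def)
next
  fix i j assume ij: "i < n" "j < m"
  have "first_rows n A $$ (i, j) = A $$ (i, j)" if "A \<in> space H" for A
    using that H SO_carrier[of A m] ij by (auto simp: first_rows_def space_haar_SO)
  then show "(\<lambda>A. first_rows n A $$ (i, j)) \<in> borel_measurable H"
    using measurable_haar_SO_index[OF H, of i j] ij n by (subst measurable_cong) auto
qed

definition haar_cdf :: "nat \<Rightarrow> nat \<Rightarrow> real mat measure \<Rightarrow> real vec measure \<Rightarrow> (nat \<Rightarrow> real) \<Rightarrow> real \<Rightarrow> real" where
  "haar_cdf n m H S w z = (\<integral>A. slice_cdf n m S w z (first_rows n A) \<partial>H)"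

lemma slice_cdf_first_rows_measurable:
  assumes H: "haar_SO m H" and S: "uniform_sphere n S" and n: "n \<le> m"
  shows "(\<lambda>A. slice_cdf n m S w z (first_rows n A)) \<in> borel_measurable H"
proof -
  interpret H: prob_space H by (rule haar_SO_prob[OF H])
  have "prob_space (distr H (projection_space n m) (first_rows n))"
    by (rule H.prob_space_distr[OF first_rows_measurable[OF H n]])
  then have "slice_cdf n m S w z \<in> borel_measurable (distr H (projection_space n m) (first_rows n))"
    by (rule measure_pair_lin_le(1)[OF _ S]) (simp add: projection_space_props)
  then show ?thesis
    using measurable_compose[OF first_rows_measurable[OF H n]] by simp
qed

lemma slice_cdf_first_rows_integrable:
  assumes H: "haar_SO m H" and S: "uniform_sphere n S" and n: "n \<le> m"
  shows "integrable H (\<lambda>A. slice_cdf n m S w z (first_rows n A))"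
proof -
  interpret H: prob_space H by (rule haar_SO_prob[OF H])
  show ?thesis
    by (rule H.integrable_const_bound[where B = 1])
      (use slice_cdf_bounds[OF uniform_sphere_prob[OF S]] slice_cdf_first_rows_measurable[OF H S n] in auto)
qed

text \<open>Truncation is invisible to \<open>lin\<close>, which reads the first \<open>n\<close>
  rows only. The average can thus be taken over full matrices, where the rotations act by right
  multiplication.\<close>

lemma haar_cdf_eq_measure:
  assumes H: "haar_SO m H" and S: "uniform_sphere n S" and n: "n \<le> m"
  shows "haar_cdf n m H S w z = measure (H \<Otimes>\<^sub>M S) {p \<in> space (H \<Otimes>\<^sub>M S). lin n m w (fst p) (snd p) \<le> z}"
proof -
  have "slice_cdf n m S w z (first_rows n A) = slice_cdf n m S w z A" if "A \<in> space H" for A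
    using that H SO_carrier[of A m] coords_first_rows[of A m]
    by (auto simp: slice_cdf_def lin_def space_haar_SO)
  then have "haar_cdf n m H S w z = (\<integral>A. slice_cdf n m S w z A \<partial>H)"
    unfolding haar_cdf_def by (intro Bochner_Integration.integral_cong) auto
  also have "\<dots> = measure (H \<Otimes>\<^sub>M S) {p \<in> space (H \<Otimes>\<^sub>M S). lin n m w (fst p) (snd p) \<le> z}"
    by (rule measure_pair_lin_le(2)[symmetric, OF haar_SO_prob[OF H] S measurable_haar_SO_index[OF H]])
      (use n in auto)
  finally show ?thesis .
qed

lemma haar_cdf_mono:
  assumes H: "haar_SO m H" and S: "uniform_sphere n S" and n: "n \<le> m"
    and d: "\<And>j. j < m \<Longrightarrow> \<bar>w j - w' j\<bar> \<le> d" and z: "z + real m * d \<le> z'"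
  shows "haar_cdf n m H S w z \<le> haar_cdf n m H S w' z'"
  unfolding haar_cdf_def
  by (intro integral_mono slice_cdf_first_rows_integrable[OF H S n] slice_cdf_mono[OF S _ d z]
      first_rows_projections[OF _ n]) (use H in \<open>auto simp: space_haar_SO\<close>)

text \<open>The values in \<open>(z, z + \<eta>]\<close> lie in the strip of half-width
  \<open>\<eta>\<close> around \<open>z\<close>.\<close>

lemma haar_cdf_modulus:
  assumes H: "haar_SO m H" and S: "uniform_sphere n S" and n: "n \<le> m" and m: "m \<ge> 2"
    and a: "a < m" "\<bar>w a\<bar> \<ge> 1" and K: "K \<ge> 1" and \<eta>: "12 * real m * real K ^ 4 * \<eta> \<le> 1" "\<eta> \<ge> 0"
  shows "haar_cdf n m H S w (z + \<eta>) \<le> haar_cdf n m H S w z + 2 * real m / K"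
proof -
  interpret H: prob_space H by (rule haar_SO_prob[OF H])
  interpret S: prob_space S by (rule uniform_sphere_prob[OF S])
  interpret pair_prob_space H S ..
  let ?N = "H \<Otimes>\<^sub>M S"
  let ?l = "\<lambda>p. lin n m w (fst p) (snd p)"
  have [measurable]: "?l \<in> borel_measurable ?N"
    by (rule measurable_lin[OF S measurable_haar_SO_index[OF H]]) (use n in auto)
  have "measure ?N {p \<in> space ?N. ?l p \<le> z + \<eta>}
      \<le> measure ?N ({p \<in> space ?N. ?l p \<le> z} \<union> {p \<in> space ?N. \<bar>?l p - z\<bar> \<le> \<eta>})"
    by (intro finite_measure_mono) (auto simp: abs_le_iff)
  also have "\<dots> \<le> measure ?N {p \<in> space ?N. ?l p \<le> z} + measure ?N {p \<in> space ?N. \<bar>?l p - z\<bar> \<le> \<eta>}"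
    by (intro measure_Un_le) measurable
  also have "measure ?N {p \<in> space ?N. \<bar>?l p - z\<bar> \<le> \<eta>} \<le> 2 * real m / K"
    by (rule prob_strip_le[where w = w and a = a, OF H S n m a K \<eta>])
  finally show ?thesis unfolding haar_cdf_eq_measure[OF H S n] by simp
qed

section \<open>Rounding and the final bound\<close>

lemma card_rounding_tests:
  fixes m M :: nat
  assumes "m \<ge> 1" "M \<ge> 1"
  defines "T \<equiv> ({..<m} \<rightarrow>\<^sub>E {- int M..int M}) \<times> {- int (3 * m * M)..int (3 * m * M)}"
  shows "finite T" "T \<noteq> {}" "ln (2 * card T) \<le> 9 * real m * real M"
proof -
  show "finite T" unfolding T_def by (intro finite_cartesian_product finite_PiE) auto
  have c: "card T = (2 * M + 1) ^ m * (6 * m * M + 1)"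
    unfolding T_def by (simp add: card_cartesian_product card_PiE nat_add_distrib nat_mult_distrib)
  then show "T \<noteq> {}" by auto
  have "ln (real (2 * card T)) = ln 2 + m * ln (1 + 2 * real M) + ln (1 + 6 * real m * real M)"
  proof -
    have "real (2 * card T) = 2 * ((1 + 2 * real M) ^ m * (1 + 6 * real m * real M))"
      unfolding c by (simp add: algebra_simps)
    moreover have "(1 + 2 * real M) ^ m > 0" "1 + 6 * real m * real M > 0"
      by (simp_all add: add_pos_nonneg)
    ultimately show ?thesis by (simp only: ln_mult_pos mult_pos_pos zero_less_numeral ln_realpow add.assoc)
  qed
  \<comment> \<open>A bound linear in \<open>M\<close> is enough although the logarithm is far
    smaller: \<open>M\<close> will be polynomial in \<open>m / \<epsilon>\<close>.\<close>
  also have "\<dots> \<le> 1 + m * (2 * real M) + 6 * real m * real M"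
    by (intro add_mono mult_left_mono ln_add_one_self_le_self) (use ln_le_minus_one[of 2] in auto)
  also have "1 \<le> real m * real M" using assms by (metis mult_mono' of_nat_0_le_iff of_nat_1 of_nat_le_iff mult_1 zero_le_one)
  finally show "ln (real (2 * card T)) \<le> 9 * real m * real M" by (simp add: mult_ac)
qed

text \<open>Rounding the normalised vector \<open>w\<close> and the threshold \<open>z\<close> to multiples of \<open>1 / M\<close> changes
  the linear form by at most \<open>(m + 1) / M\<close>, which the modulus of continuity absorbs.\<close>

lemma cdf_deviation_rounding:
  fixes D E :: "(nat \<Rightarrow> real) \<Rightarrow> real \<Rightarrow> real"
  assumes M: "M \<ge> 1"
    and mono: "\<And>w w' d z z'. (\<And>j. j < m \<Longrightarrow> \<bar>w j - w' j\<bar> \<le> d) \<Longrightarrow> z + real m * d \<le> z' \<Longrightarrow> D w z \<le> D w' z'"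
      "\<And>w w' d z z'. (\<And>j. j < m \<Longrightarrow> \<bar>w j - w' j\<bar> \<le> d) \<Longrightarrow> z + real m * d \<le> z' \<Longrightarrow> E w z \<le> E w' z'"
    and tests: "\<And>\<kappa> k. \<kappa> \<in> {..<m} \<rightarrow>\<^sub>E {- int M..int M} \<Longrightarrow> k \<in> {- int (3 * m * M)..int (3 * m * M)} \<Longrightarrow>
      \<bar>D (\<lambda>j. \<kappa> j / M) (k / M) - E (\<lambda>j. \<kappa> j / M) (k / M)\<bar> \<le> e"
    and modulus: "\<And>z. E w (z + (2 * real m + 1) / M) \<le> E w z + e"
    and w: "\<And>j. j < m \<Longrightarrow> \<bar>w j\<bar> \<le> 1" and z: "\<bar>z\<bar> \<le> real m" and m: "m \<ge> 1"
  shows "\<bar>D w z - E w z\<bar> \<le> 2 * e"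
proof -
  have M0: "real M > 0" using M by simp
  have mM: "int m * int M \<ge> int m" "int m * int M \<ge> 1"
    using M m by (simp_all add: mult_le_cancel_left1 flip: of_nat_mult)
  define \<kappa> where "\<kappa> = (\<lambda>j\<in>{..<m}. \<lfloor>w j * M\<rfloor>)"
  define w' where "w' = (\<lambda>j. \<kappa> j / M)"
  have \<kappa>: "\<kappa> \<in> {..<m} \<rightarrow>\<^sub>E {- int M..int M}"
  proof
    fix j assume j: "j \<in> {..<m}"
    then have "- 1 * real M \<le> w j * M" "w j * M \<le> 1 * real M"
      using w[of j] by (intro mult_right_mono; simp add: abs_le_iff)+
    then show "\<kappa> j \<in> {- int M..int M}" using j by (auto simp: \<kappa>_def le_floor_iff floor_le_iff)
  qed (auto simp: \<kappa>_def)
  have near: "\<bar>w j - w' j\<bar> \<le> 1 / M" if "j < m" for j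
  proof -
    have "\<bar>w j * M - \<lfloor>w j * M\<rfloor>\<bar> \<le> 1" by linarith
    then have "\<bar>w j * M - \<lfloor>w j * M\<rfloor>\<bar> / M \<le> 1 / M" by (intro divide_right_mono) auto
    moreover have "w j - w' j = (w j * M - \<lfloor>w j * M\<rfloor>) / M"
      using that M0 by (simp add: w'_def \<kappa>_def diff_divide_distrib)
    ultimately show ?thesis using M0 by (simp add: abs_divide)
  qed
  then have near': "\<bar>w' j - w j\<bar> \<le> 1 / M" if "j < m" for j
    using that by (simp add: abs_minus_commute)
  have zM: "- (real m * M) \<le> z * M" "z * M \<le> real m * M"
    using mult_right_mono[of "- real m" z "real M"] mult_right_mono[of z "real m" "real M"] z
    by (simp_all add: abs_le_iff)
  have up: "D w z \<le> E w z + 2 * e"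
  proof -
    \<comment> \<open>The summand \<open>m\<close> pays for passing from \<open>w\<close> to
      \<open>w'\<close>. Returning to \<open>w\<close> on the Haar side costs another
      \<open>m / M\<close> and the ceiling \<open>1 / M\<close>, which is the shift
      \<open>(2 * m + 1) / M\<close> in the modulus.\<close>
    define k where "k = \<lceil>z * M\<rceil> + int m"
    have "\<lceil>z * M\<rceil> \<le> int m * int M" "- (int m * int M) \<le> \<lceil>z * M\<rceil>"
      using zM by (simp_all add: ceiling_le_iff le_ceiling_iff)
    then have k: "k \<in> {- int (3 * m * M)..int (3 * m * M)}" using mM by (simp add: k_def)
    have "(z * M + m) / M \<le> k / M" "(k + m) / M \<le> (z * M + (2 * real m + 1)) / M"
      using M0 unfolding k_def by (intro divide_right_mono; linarith)+
    then have k1: "z + m * (1 / M) \<le> k / M" and k2: "k / M + m * (1 / M) \<le> z + (2 * real m + 1) / M"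
      using M0 by (simp_all add: add_divide_distrib)
    have "D w z \<le> D w' (k / M)" by (rule mono(1)[OF near k1])
    also have "\<dots> \<le> E w' (k / M) + e" using tests[OF \<kappa> k] unfolding w'_def by linarith
    also have "E w' (k / M) \<le> E w (z + (2 * real m + 1) / M)" by (rule mono(2)[OF near' k2])
    also note modulus
    finally show ?thesis by simp
  qed
  have low: "E w z \<le> D w z + 2 * e"
  proof -
    define k where "k = \<lfloor>z * M\<rfloor> - int m"
    have "\<lfloor>z * M\<rfloor> \<le> int m * int M" "- (int m * int M) \<le> \<lfloor>z * M\<rfloor>"
      using zM by (simp_all add: floor_le_iff le_floor_iff)
    then have k: "k \<in> {- int (3 * m * M)..int (3 * m * M)}" using mM by (simp add: k_def)
    have "(k + m) / M \<le> z * M / M" "(z * M - (2 * real m + 1) + m) / M \<le> k / M"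
      using M0 unfolding k_def by (intro divide_right_mono; linarith)+
    then have k1: "k / M + m * (1 / M) \<le> z" and k2: "z - (2 * real m + 1) / M + m * (1 / M) \<le> k / M"
      using M0 by (simp_all add: add_divide_distrib diff_divide_distrib)
    \<comment> \<open>For the lower estimate the modulus is applied first, at the shifted threshold,
      so again it is needed for \<open>E\<close> alone.\<close>
    have "E w z \<le> E w (z - (2 * real m + 1) / M) + e" using modulus[of "z - (2 * real m + 1) / M"] by simp
    also have "E w (z - (2 * real m + 1) / M) \<le> E w' (k / M)" by (rule mono(2)[OF near k2])
    also have "\<dots> \<le> D w' (k / M) + e" using tests[OF \<kappa> k] unfolding w'_def by linarith
    also have "D w' (k / M) \<le> D w z" by (rule mono(1)[OF near' k1])
    finally show ?thesis by simp
  qed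
  show ?thesis using up low by linarith
qed

text \<open>One \<open>e\<close> is the sampling error on the rounded tests, the other is the
  modulus of the Haar side. The sample is drawn from \<open>H\<close> and then truncated.\<close>

lemma exists_projection_sample:
  fixes K M :: nat
  assumes H: "haar_SO m H" and S: "uniform_sphere n S" and n: "n \<le> m" and m: "m \<ge> 2"
    and e: "e > 0" and K: "K \<ge> 1" "2 * real m / K \<le> e"
    and M: "M \<ge> 1" "12 * real m * real K ^ 4 * ((2 * real m + 1) / M) \<le> 1"
    and Y: "finite Y" "Y \<noteq> {}" and size: "9 * real m * real M \<le> e\<^sup>2 / 4 * card Y"
  shows "\<exists>P\<in>Y \<rightarrow> projections n m. \<forall>w z.
    \<bar>(\<Sum>y\<in>Y. slice_cdf n m S w z (P y)) / card Y - haar_cdf n m H S w z\<bar> \<le> 2 * e"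
proof -
  interpret H: prob_space H by (rule haar_SO_prob[OF H])
  interpret S: prob_space S by (rule uniform_sphere_prob[OF S])
  define T where "T = ({..<m} \<rightarrow>\<^sub>E {- int M..int M}) \<times> {- int (3 * m * M)..int (3 * m * M)}"
  have T: "finite T" "T \<noteq> {}" "ln (2 * card T) \<le> 9 * real m * real M"
    using card_rounding_tests[of m M] m M unfolding T_def by auto
  define f where "f = (\<lambda>(\<kappa> :: nat \<Rightarrow> int, k :: int) A. slice_cdf n m S (\<lambda>j. \<kappa> j / M) (k / M) (first_rows n A))"
  have "\<exists>B\<in>Y \<rightarrow> space H. \<forall>t\<in>T. \<bar>(\<Sum>y\<in>Y. f t (B y)) / card Y - H.expectation (f t)\<bar> \<le> e"
  proof (rule H.exists_uniform_sample[OF T(1,2) Y e])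
    fix t
    show "f t \<in> borel_measurable H"
      by (cases t) (simp add: f_def slice_cdf_first_rows_measurable[OF H S n])
    show "f t A \<in> {0..1}" for A
      using slice_cdf_bounds[OF S.prob_space_axioms] by (cases t) (simp add: f_def)
  qed (use T(3) size in linarith)
  then obtain B where B: "B \<in> Y \<rightarrow> space H"
    and dev: "\<And>t. t \<in> T \<Longrightarrow> \<bar>(\<Sum>y\<in>Y. f t (B y)) / card Y - H.expectation (f t)\<bar> \<le> e"
    by blast
  define P where "P y = first_rows n (B y)" for y
  have P: "P y \<in> projections n m" if "y \<in> Y" for y
    using B that H first_rows_projections[OF _ n] by (auto simp: P_def space_haar_SO)
  define D where "D w z = (\<Sum>y\<in>Y. slice_cdf n m S w z (P y)) / card Y" for w z
  define E where "E w z = haar_cdf n m H S w z" for w z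
  have cY: "real (card Y) > 0" using Y by (simp add: card_gt_0_iff)
  have D_mono: "D w z \<le> D w' z'" if "\<And>j. j < m \<Longrightarrow> \<bar>w j - w' j\<bar> \<le> d" "z + real m * d \<le> z'" for w w' d z z'
    unfolding D_def by (intro divide_right_mono sum_mono slice_cdf_mono[OF S P that]) auto
  have E_mono: "E w z \<le> E w' z'" if "\<And>j. j < m \<Longrightarrow> \<bar>w j - w' j\<bar> \<le> d" "z + real m * d \<le> z'" for w w' d z z'
    unfolding E_def by (rule haar_cdf_mono[OF H S n that])
  have tests: "\<bar>D (\<lambda>j. \<kappa> j / M) (k / M) - E (\<lambda>j. \<kappa> j / M) (k / M)\<bar> \<le> e"
    if "\<kappa> \<in> {..<m} \<rightarrow>\<^sub>E {- int M..int M}" "k \<in> {- int (3 * m * M)..int (3 * m * M)}" for \<kappa> k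
    using dev[of "(\<kappa>, k)"] that by (simp add: T_def f_def D_def E_def haar_cdf_def P_def)
  \<comment> \<open>Handles the degenerate pairs, where the conditional distribution function is the
    same for all projections: \<open>w = 0\<close>, or a threshold outside the range of the
    form.\<close>
  have const: "\<bar>D w z - E w z\<bar> \<le> 2 * e" if "\<And>A. A \<in> projections n m \<Longrightarrow> slice_cdf n m S w z A = c" for w z c
  proof -
    have "D w z = c" unfolding D_def using that P cY by simp
    moreover have "E w z = (\<integral>A. c \<partial>H)"
      unfolding E_def haar_cdf_def
      by (intro Bochner_Integration.integral_cong refl that first_rows_projections[OF _ n])
        (use H in \<open>simp add: space_haar_SO\<close>)
    ultimately show ?thesis using e by (simp add: H.prob_space)
  qed
  have normalised: "\<bar>D w z - E w z\<bar> \<le> 2 * e"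
    if w: "\<And>j. j < m \<Longrightarrow> \<bar>w j\<bar> \<le> 1" and a: "a < m" "\<bar>w a\<bar> \<ge> 1" for w z a
  proof (cases "\<bar>z\<bar> \<le> real m")
    case True
    have modulus: "E w (x + (2 * real m + 1) / M) \<le> E w x + e" for x
    proof -
      have "E w (x + (2 * real m + 1) / M) \<le> E w x + 2 * real m / K"
        unfolding E_def by (rule haar_cdf_modulus[where w = w and a = a, OF H S n m a K(1) M(2)]) simp
      then show ?thesis using K(2) by linarith
    qed
    show ?thesis
      by (rule cdf_deviation_rounding[where D = D and E = E and w = w, OF M(1) D_mono E_mono tests modulus w True])
        (use m in auto)
  next
    case False
    then show ?thesis by (intro const[of _ _ "if z > 0 then 1 else 0"] slice_cdf_extreme[OF S _ w]) auto
  qed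
  have "\<bar>D w z - E w z\<bar> \<le> 2 * e" for w z
  proof (cases "\<exists>j<m. w j \<noteq> 0")
    case False
    then show ?thesis
      by (intro const[of _ _ "if 0 \<le> z then 1 else 0"] slice_cdf_zero S.prob_space_axioms) auto
  next
    case True
    \<comment> \<open>Dividing by the largest entry yields entries in [-1, 1] for the rounding and
      an entry of modulus 1 for the anticoncentration.\<close>
    define s where "s = Max ((\<lambda>j. \<bar>w j\<bar>) ` {..<m})"
    have fin: "finite ((\<lambda>j. \<bar>w j\<bar>) ` {..<m})" "(\<lambda>j. \<bar>w j\<bar>) ` {..<m} \<noteq> {}"
      using m by (auto simp: lessThan_empty_iff)
    have le: "\<bar>w j\<bar> \<le> s" if "j < m" for j unfolding s_def using that by (intro Max_ge fin) auto
    obtain a where a: "a < m" "\<bar>w a\<bar> = s" using Max_in[OF fin] unfolding s_def by auto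
    obtain j where "j < m" "w j \<noteq> 0" using True by blast
    then have s: "s > 0" using le[of j] by linarith
    have "D w z = D (\<lambda>j. w j / s) (z / s)" "E w z = E (\<lambda>j. w j / s) (z / s)"
      unfolding D_def E_def haar_cdf_def by (simp_all only: slice_cdf_scale[OF s, of n m S w z])
    moreover have "\<bar>D (\<lambda>j. w j / s) (z / s) - E (\<lambda>j. w j / s) (z / s)\<bar> \<le> 2 * e"
      by (rule normalised[of _ a]) (use le a s in \<open>auto simp: abs_divide\<close>)
    ultimately show ?thesis by simp
  qed
  then show ?thesis using P unfolding D_def E_def by blast
qed

text \<open>All sizes are measured by q = m / \<epsilon>, which is at least 4; numerical constants
  are then absorbed into powers of q.\<close>

lemma sampling_parameters:
  fixes m :: nat and \<epsilon> :: real
  assumes m: "m \<ge> 2" and \<epsilon>: "0 < \<epsilon>" "\<epsilon> < 1 / 2"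
  obtains K M r :: nat where "K \<ge> 1" "2 * real m / K \<le> \<epsilon> / 2"
    "M \<ge> 1" "12 * real m * real K ^ 4 * ((2 * real m + 1) / M) \<le> 1"
    "9 * real m * real M \<le> (\<epsilon> / 2)\<^sup>2 / 4 * 2 ^ r" "real r \<le> 19 * log 2 (real m / \<epsilon>)"
proof -
  define q where "q = real m / \<epsilon>"
  have m\<epsilon>: "real m = q * \<epsilon>" using \<epsilon> by (simp add: q_def)
  have "2 * 2 \<le> real m * (1 / \<epsilon>)"
    using m \<epsilon> by (intro mult_mono) (auto simp: field_simps)
  then have q: "q \<ge> 4" by (simp add: q_def)
  \<comment> \<open>\<open>K \<ge> 4 * q\<close> means \<open>4 * m \<le> K * \<epsilon>\<close>,
    which is the required bound on \<open>2 * m / K\<close>.\<close>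
  define K where "K = nat \<lceil>4 * q\<rceil>"
  have K: "4 * q \<le> real K" "real K \<le> 5 * q" using q unfolding K_def by linarith+
  have K1: "K \<ge> 1" using K q by linarith
  have "4 * real m = 4 * q * \<epsilon>" by (simp add: m\<epsilon>)
  also have "\<dots> \<le> real K * \<epsilon>" using K \<epsilon> by (intro mult_right_mono) auto
  finally have K2: "2 * real m / K \<le> \<epsilon> / 2" using K1 by (simp add: field_simps)
  \<comment> \<open>36 = 12 * 3, where the 3 comes from
    \<open>2 * m + 1 \<le> 3 * m\<close>.\<close>
  define M where "M = 36 * m\<^sup>2 * K ^ 4"
  have M1: "M \<ge> 1" using m K1 by (simp add: M_def Suc_le_eq)
  have M2: "12 * real m * real K ^ 4 * ((2 * real m + 1) / M) \<le> 1"
  proof -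
    have "12 * real m * real K ^ 4 * (2 * real m + 1) \<le> 12 * real m * real K ^ 4 * (3 * real m)"
      using m by (intro mult_left_mono) auto
    also have "\<dots> = real M" by (simp add: M_def power2_eq_square)
    finally show ?thesis using M1 by (simp add: divide_le_eq)
  qed
  \<comment> \<open>A sample of size q^18 is large enough, and rounding up costs one more bit, at
    most \<open>log 2 q\<close>. Hence the constant 19.\<close>
  define r where "r = nat \<lceil>18 * log 2 q\<rceil>"
  have lq: "log 2 q \<ge> 1" using q by (simp add: le_log_iff)
  have r: "18 * log 2 q \<le> real r" "real r \<le> 19 * log 2 q" using lq unfolding r_def by linarith+
  have "q ^ 18 = (2 powr log 2 q) powr 18" using q by simp
  also have "\<dots> = 2 powr (18 * log 2 q)" by (simp only: powr_powr mult.commute)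
  also have "\<dots> \<le> 2 powr real r" using r by simp
  finally have q18: "q ^ 18 \<le> 2 ^ r" by (simp add: powr_realpow)
  have "real K ^ 4 \<le> (5 * q) ^ 4" using K by (intro power_mono) auto
  moreover have "real M = 36 * (real m)\<^sup>2 * real K ^ 4" by (simp add: M_def)
  ultimately have "9 * real m * real M \<le> 9 * real m * (36 * (real m)\<^sup>2 * (5 * q) ^ 4)"
    by (simp only:) (intro mult_left_mono; simp)
  also have "\<dots> = \<epsilon>\<^sup>2 * (202500 * \<epsilon> * q ^ 7)"
  proof -
    have "9 * real m * (36 * (real m)\<^sup>2 * (5 * q) ^ 4) = \<epsilon>\<^sup>2 * (202500 * \<epsilon> * (q * q\<^sup>2 * q ^ 4))"
      unfolding m\<epsilon> by (simp add: power_mult_distrib)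
    also have "q * q\<^sup>2 * q ^ 4 = q ^ 7" by (simp add: eval_nat_numeral)
    finally show ?thesis .
  qed
  also have "\<dots> \<le> \<epsilon>\<^sup>2 * (q ^ 18 / 16)"
  proof (intro mult_left_mono)
    \<comment> \<open>The exponent 18 is 7 + 11: q^7 comes from m^3 and K^4, and 4^11 = 4194304
      exceeds 16 * 202500 = 3240000, where 202500 = 9 * 36 * 5^4.\<close>
    have "(4::real) ^ 11 \<le> q ^ 11" using q by (intro power_mono) auto
    then have "3240000 * q ^ 7 \<le> q ^ 11 * q ^ 7" using q by (intro mult_right_mono) auto
    also have "\<dots> = q ^ 18" by (simp flip: power_add)
    finally have "202500 * q ^ 7 \<le> q ^ 18 / 16" by simp
    moreover have "202500 * \<epsilon> * q ^ 7 \<le> 202500 * q ^ 7"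
      using \<epsilon> q by (simp add: mult_le_cancel_right)
    ultimately show "202500 * \<epsilon> * q ^ 7 \<le> q ^ 18 / 16" by linarith
  qed simp
  also have "\<dots> \<le> \<epsilon>\<^sup>2 * (2 ^ r / 16)" using q18 by (intro mult_left_mono) auto
  also have "\<dots> = (\<epsilon> / 2)\<^sup>2 / 4 * 2 ^ r" by (simp add: power_divide)
  finally have size: "9 * real m * real M \<le> (\<epsilon> / 2)\<^sup>2 / 4 * 2 ^ r" .
  show thesis by (rule that[OF K1 K2 M1 M2 size r(2)[unfolded q_def]])
qed

text \<open>By Fubini and change of variables the two probabilities in \<open>dcdf\<close> become an
  average over \<open>Y\<close> and \<open>haar_cdf\<close>; a bound for every \<open>z\<close> then
  bounds the supremum.\<close>

lemma is_PRP_distr_uniform: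
  assumes n: "n \<le> m" and Y: "finite Y" "Y \<noteq> {}" and P: "P \<in> Y \<rightarrow> projections n m"
    and dev: "\<And>H S w z. haar_SO m H \<Longrightarrow> uniform_sphere n S \<Longrightarrow>
      \<bar>(\<Sum>y\<in>Y. slice_cdf n m S w z (P y)) / card Y - haar_cdf n m H S w z\<bar> \<le> \<epsilon>"
  shows "is_PRP \<epsilon> n m (distr (uniform_count_measure Y) (projection_space n m) P)"
proof -
  interpret U: prob_space "uniform_count_measure Y" by (rule prob_space_uniform_count_measure[OF Y])
  let ?D = "distr (uniform_count_measure Y) (projection_space n m) P"
  have Pm: "P \<in> measurable (uniform_count_measure Y) (projection_space n m)"
    using P by (auto simp: measurable_def space_uniform_count_measure sets_uniform_count_measure projection_space_props)
  have D: "prob_space ?D" by (rule U.prob_space_distr[OF Pm])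
  have "dcdf (?D \<Otimes>\<^sub>M S) (\<lambda>(P, x). scalar_prod (P *\<^sub>v w) x)
      (random_projection n m H \<Otimes>\<^sub>M S) (\<lambda>(Q, x). scalar_prod (Q *\<^sub>v w) x) \<le> \<epsilon>"
    if H: "haar_SO m H" and S: "uniform_sphere n S" and w: "w \<in> carrier_vec m" for H S w
  proof -
    interpret H: prob_space H by (rule haar_SO_prob[OF H])
    have fr: "first_rows n \<in> measurable H (projection_space n m)" by (rule first_rows_measurable[OF H n])
    have R: "prob_space (random_projection n m H)"
      unfolding random_projection_def by (rule H.prob_space_distr[OF fr])
    let ?w = "\<lambda>j. w $ j"
    \<comment> \<open>Stated for an arbitrary law \<open>N\<close> because it is applied twice, to
      the sampled law and to \<open>random_projection\<close>.\<close>
    have sliced: "slice_cdf n m S ?w z \<in> borel_measurable N \<and>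
        measure (N \<Otimes>\<^sub>M S) {p \<in> space (N \<Otimes>\<^sub>M S). (case p of (P, x) \<Rightarrow> scalar_prod (P *\<^sub>v w) x) \<le> z}
        = (\<integral>P. slice_cdf n m S ?w z P \<partial>N)"
      if N: "prob_space N" "sets N = sets (projection_space n m)" for N z
    proof -
      have spN: "space N = projections n m"
        unfolding sets_eq_imp_space_eq[OF N(2)] by (rule projection_space_props(1))
      have L: "(case p of (P, x) \<Rightarrow> scalar_prod (P *\<^sub>v w) x) = lin n m ?w (fst p) (snd p)"
        if "p \<in> space (N \<Otimes>\<^sub>M S)" for p
      proof -
        have "fst p \<in> projections n m" "snd p \<in> unit_sphere n"
          using that spN space_uniform_sphere[OF S] by (auto simp: space_pair_measure)
        then have "fst p \<in> carrier_mat n m" "snd p \<in> carrier_vec n"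
          by (simp_all add: projections_def unit_sphere_def)
        from scalar_prod_mult_eq_lin[OF this(1) w this(2)] show ?thesis
          unfolding case_prod_beta .
      qed
      have "{p \<in> space (N \<Otimes>\<^sub>M S). (case p of (P, x) \<Rightarrow> scalar_prod (P *\<^sub>v w) x) \<le> z}
          = {p \<in> space (N \<Otimes>\<^sub>M S). lin n m ?w (fst p) (snd p) \<le> z}"
        by (intro Collect_cong conj_cong refl) (simp only: L)
      then show ?thesis
        using measure_pair_lin_le[OF N(1) S projection_space_index_cong[OF N(2)], of m ?w z] by simp
    qed
    have mp: "slice_cdf n m S ?w z \<in> borel_measurable (projection_space n m)" for z
      using sliced[OF D, of z] by simp
    have "\<bar>measure (?D \<Otimes>\<^sub>M S) {p \<in> space (?D \<Otimes>\<^sub>M S). (case p of (P, x) \<Rightarrow> scalar_prod (P *\<^sub>v w) x) \<le> z}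
        - measure (random_projection n m H \<Otimes>\<^sub>M S)
          {p \<in> space (random_projection n m H \<Otimes>\<^sub>M S). (case p of (P, x) \<Rightarrow> scalar_prod (P *\<^sub>v w) x) \<le> z}\<bar> \<le> \<epsilon>" for z
    proof -
      have "(\<integral>P. slice_cdf n m S ?w z P \<partial>?D) = (\<Sum>y\<in>Y. slice_cdf n m S ?w z (P y)) / card Y"
        by (subst integral_distr[OF Pm mp]) (rule integral_uniform_count_measure[OF Y(1)])
      moreover have "(\<integral>P. slice_cdf n m S ?w z P \<partial>random_projection n m H) = haar_cdf n m H S ?w z"
        unfolding random_projection_def haar_cdf_def by (rule integral_distr[OF fr mp])
      ultimately show ?thesis
        using sliced[OF D, of z] sliced[OF R, of z] dev[OF H S, of ?w z] by (simp add: random_projection_def)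
    qed
    then show ?thesis unfolding dcdf_def by (intro cSUP_least) auto
  qed
  then show ?thesis using D by (simp add: is_PRP_def projection_space_props)
qed

theorem mainTheorem2:
  shows "\<exists>c C :: real. c > 0 \<and> C > 0 \<and>
    (\<forall>(\<epsilon> :: real) (m :: nat) (n :: nat).
       0 < \<epsilon> \<longrightarrow> \<epsilon> < 1 / 2 \<longrightarrow> 0 < m \<longrightarrow> m = n\<^sup>2 \<longrightarrow>
       real m \<ge> c * (log 2 (1 / \<epsilon>))\<^sup>2 \<longrightarrow>
       (\<exists>D r. is_PRP \<epsilon> n m D \<and> has_seed_length n m D r \<and>
              real r \<le> C * log 2 (real m / \<epsilon>)))"
proof (rule exI[of _ 1], rule exI[of _ 19], intro conjI allI impI)
  fix \<epsilon> :: real and m n :: nat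
  assume \<epsilon>: "0 < \<epsilon>" "\<epsilon> < 1 / 2" and m0: "0 < m" and mn: "m = n\<^sup>2"
    and ge: "real m \<ge> 1 * (log 2 (1 / \<epsilon>))\<^sup>2"
  \<comment> \<open>The lower bound on \<open>m\<close> excludes \<open>m = 1\<close>, where
    \<open>SO 1\<close> is trivial and there is no plane to rotate.\<close>
  have "log 2 (1 / \<epsilon>) > 1" using \<epsilon> by (simp add: less_log_iff field_simps)
  then have "(log 2 (1 / \<epsilon>))\<^sup>2 > 1" by (simp add: one_less_power)
  then have m: "m \<ge> 2" using ge by linarith
  have n: "n \<le> m" using mn by (simp add: power2_eq_square)
  obtain K M r :: nat where pars: "K \<ge> 1" "2 * real m / K \<le> \<epsilon> / 2"
    "M \<ge> 1" "12 * real m * real K ^ 4 * ((2 * real m + 1) / M) \<le> 1"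
    and size: "9 * real m * real M \<le> (\<epsilon> / 2)\<^sup>2 / 4 * 2 ^ r" and r: "real r \<le> 19 * log 2 (real m / \<epsilon>)"
    using sampling_parameters[OF m \<epsilon>] .
  define Y where "Y = {y :: bool list. length y = r}"
  have Y_eq: "Y = {y. set y \<subseteq> UNIV \<and> length y = r}" by (simp add: Y_def)
  have cY: "card Y = 2 ^ r" unfolding Y_eq by (subst card_lists_length_eq) auto
  have Y: "finite Y" "Y \<noteq> {}" using cY by (auto intro: card_ge_0_finite)
  \<comment> \<open>The sample has to be fixed before \<open>H\<close> and \<open>S\<close> are
    given. It is chosen for one pair and carried over to all others by uniqueness.\<close>
  have "\<exists>P\<in>Y \<rightarrow> projections n m. \<forall>H S w z. haar_SO m H \<longrightarrow> uniform_sphere n S \<longrightarrow>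
      \<bar>(\<Sum>y\<in>Y. slice_cdf n m S w z (P y)) / card Y - haar_cdf n m H S w z\<bar> \<le> \<epsilon>"
  proof (cases "\<exists>H S. haar_SO m H \<and> uniform_sphere n S")
    case True
    then obtain H S where H: "haar_SO m H" and S: "uniform_sphere n S" by blast
    have "\<epsilon> / 2 > 0" using \<epsilon> by simp
    from exists_projection_sample[OF H S n m this pars Y] size
    obtain P where P: "P \<in> Y \<rightarrow> projections n m"
      and dev: "\<And>w z. \<bar>(\<Sum>y\<in>Y. slice_cdf n m S w z (P y)) / card Y - haar_cdf n m H S w z\<bar> \<le> \<epsilon>"
      by (auto simp: cY)
    have "\<bar>(\<Sum>y\<in>Y. slice_cdf n m S' w z (P y)) / card Y - haar_cdf n m H' S' w z\<bar> \<le> \<epsilon>"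
      if H': "haar_SO m H'" and S': "uniform_sphere n S'" for H' S' w z
    proof -
      have eq: "slice_cdf n m S' w z A = slice_cdf n m S w z A" if "A \<in> projections n m" for A
        using that by (intro slice_cdf_sphere_unique[OF S' S]) (simp add: projections_def)
      have "(\<Sum>y\<in>Y. slice_cdf n m S' w z (P y)) = (\<Sum>y\<in>Y. slice_cdf n m S w z (P y))"
        using P by (intro sum.cong refl eq) auto
      moreover have "haar_cdf n m H' S' w z = haar_cdf n m H S w z"
        unfolding haar_SO_unique[OF H' H] haar_cdf_def
        by (intro Bochner_Integration.integral_cong refl eq first_rows_projections[OF _ n])
          (use H in \<open>simp add: space_haar_SO\<close>)
      ultimately show ?thesis using dev by simp
    qed
    then show ?thesis using P by blast
  next
    \<comment> \<open>The deviation bound is vacuous in this case, but the seed still needs a map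
      into the projections; a constant one will do.\<close>
    case False
    have "1\<^sub>m m \<in> SO m" by (simp add: SO_def orthogonal_mats_def)
    then have "(\<lambda>_. first_rows n (1\<^sub>m m)) \<in> Y \<rightarrow> projections n m"
      using first_rows_projections[OF _ n] by auto
    then show ?thesis using False by blast
  qed
  then obtain P where P: "P \<in> Y \<rightarrow> projections n m"
    and dev: "\<And>H S w z. haar_SO m H \<Longrightarrow> uniform_sphere n S \<Longrightarrow>
      \<bar>(\<Sum>y\<in>Y. slice_cdf n m S w z (P y)) / card Y - haar_cdf n m H S w z\<bar> \<le> \<epsilon>"
    by blast
  define D where "D = distr (uniform_count_measure Y) (projection_space n m) P"
  have "is_PRP \<epsilon> n m D"
    unfolding D_def by (rule is_PRP_distr_uniform[OF n Y P dev])
  moreover have "has_seed_length n m D r"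
    unfolding has_seed_length_def D_def Y_def using P by (auto simp: Y_def)
  ultimately show "\<exists>D r. is_PRP \<epsilon> n m D \<and> has_seed_length n m D r \<and> real r \<le> 19 * log 2 (real m / \<epsilon>)"
    using r by blast
qed simp_all

end
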